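(* Let $\mathscr{E}$ be a topos which is a geometric category and such that for every ring object $A$, right $A$-module $M$ and left $A$-module $N$ the functor $\mathrm{Ab}(\mathscr{E})\to\mathrm{Ab}$, $P\mapsto\mathrm{Hom}_A(M,[N,P]_{\mathbf Z})$ is representable. Let $A$ be a ring object in $\mathscr{E}$, $M$ a right $A$-module and $N$ a left $A$-module, and let $\varphi(x)$ be the formula, in a free variable $x$ of type $M\otimes_AN$, $$\bigvee_{p\ge0}\exists m_1,\ldots,m_p{:}M,\ \exists n_1,\ldots,n_p{:}N\ \Big(x=\sum_{i=1}^pm_i\otimes n_i\Big).$$ Then $\vDash\varphi(x)$ for $x{:}M\otimes_AN$. Hence $M\otimes_AN\cong\llbracket\varphi\rrbracket$.
   Context: $\mathrm{Ab}(\mathscr{E})$ is the category of abelian group objects in $\mathscr{E}$. $\vDash\varphi$ means that the formula $\varphi$ of the internal language is valid in $\mathscr{E}$, and $\llbracket\varphi\rrbracket\rightarrowtail M\otimes_AN$ is the subobject defined by $\varphi$; since $\mathscr{E}$ is geometric (subobject posets have arbitrary unions stable under pullback; e.g. $\mathscr{E}$ a Grothendieck topos), infinite disjunctions are interpreted as unions of subobjects. The index $p$ ranges over (external) natural numbers. For abelian group objects $N,P$, $[N,P]_{\mathbf Z}$ is the subobject of the topos internal hom $[N,P]$ of additive maps; if $N$ is a left $A$-module it is a right $A$-module via $(fa)(n)=f(an)$. $M\otimes_AN\in\mathrm{Ab}(\mathscr{E})$ is the representing object: $\mathrm{Hom}_{\mathbf Z}(M\otimes_AN,P)\cong\mathrm{Hom}_A(M,[N,P]_{\mathbf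 Z})$, naturally in $P$. The morphism $\otimes:M\times N\to M\otimes_AN$ is the transpose of the unit $\eta_M:M\to[N,M\otimes_AN]_{\mathbf Z}\rightarrowtail[N,M\otimes_AN]$, and $m\otimes n$ denotes $\otimes(m,n)$. *)

theory Defs
  imports Main
begin

section \<open>Toposes\<close>

text \<open>
  A (small) category, presented by its objects and arrows. Finite limits, exponentials and the
  subobject classifier are chosen; arrows such as pairings, transposes and factorisations are
  recovered from their universal properties by definite description. Composition is written in
  applicative order.
\<close>

record ('o, 'm) cat_data =
  Obj :: "'o set"
  Arr :: "'m set"
  Dom :: "'m \<Rightarrow> 'o"
  Cod :: "'m \<Rightarrow> 'o"
  Id :: "'o \<Rightarrow> 'm"
  Comp :: "'m \<Rightarrow> 'm \<Rightarrow> 'm" (infixr "\<cdot>\<index>" 70)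

text \<open>
  \<open>Eql f g\<close> is the equaliser arrow, so the equaliser object is \<open>Dom (Eql f g)\<close>.
  \<open>Exp N P\<close> is the internal hom \<open>[N, P]\<close>, with evaluation \<open>Ev N P : [N, P] \<times> N \<rightarrow> P\<close>.
\<close>

record ('o, 'm) topos_data = "('o, 'm) cat_data" +
  One :: 'o
  Prd :: "'o \<Rightarrow> 'o \<Rightarrow> 'o"
  Fst :: "'o \<Rightarrow> 'o \<Rightarrow> 'm"
  Snd :: "'o \<Rightarrow> 'o \<Rightarrow> 'm"
  Eql :: "'m \<Rightarrow> 'm \<Rightarrow> 'm"
  Exp :: "'o \<Rightarrow> 'o \<Rightarrow> 'o"
  Ev :: "'o \<Rightarrow> 'o \<Rightarrow> 'm"
  Omega :: 'o
  Tru :: 'm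

context
  fixes E :: "('o, 'm, 'e) cat_data_scheme" (structure)
begin

definition hom :: "'o \<Rightarrow> 'o \<Rightarrow> 'm set" where
  "hom X Y = {f \<in> Arr E. Dom E f = X \<and> Cod E f = Y}"

definition is_mono :: "'m \<Rightarrow> bool" where
  "is_mono m \<longleftrightarrow> m \<in> Arr E \<and>
    (\<forall>f\<in>Arr E. \<forall>g\<in>Arr E. Dom E f = Dom E g \<longrightarrow> Cod E f = Dom E m \<longrightarrow> Cod E g = Dom E m \<longrightarrow>
      m \<cdot> f = m \<cdot> g \<longrightarrow> f = g)"

definition is_iso :: "'m \<Rightarrow> bool" where
  "is_iso f \<longleftrightarrow> f \<in> Arr E \<and>
    (\<exists>g\<in>hom (Cod E f) (Dom E f). g \<cdot> f = Id E (Dom E f) \<and> f \<cdot> g = Id E (Cod E f))"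

definition is_pullback :: "'m \<Rightarrow> 'm \<Rightarrow> 'm \<Rightarrow> 'm \<Rightarrow> bool" where
  "is_pullback f g p q \<longleftrightarrow>
    f \<in> Arr E \<and> g \<in> Arr E \<and> p \<in> Arr E \<and> q \<in> Arr E \<and>
    Cod E f = Cod E g \<and> Dom E p = Dom E q \<and> Cod E p = Dom E f \<and> Cod E q = Dom E g \<and>
    f \<cdot> p = g \<cdot> q \<and>
    (\<forall>a\<in>Arr E. \<forall>b\<in>Arr E. Dom E a = Dom E b \<longrightarrow> Cod E a = Dom E f \<longrightarrow> Cod E b = Dom E g \<longrightarrow>
      f \<cdot> a = g \<cdot> b \<longrightarrow> (\<exists>!h. h \<in> hom (Dom E a) (Dom E p) \<and> p \<cdot> h = a \<and> q \<cdot> h = b))"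

text \<open>
  Subobjects are represented by monomorphisms; two representatives are the same subobject when
  each is \<open>sub_le\<close> the other. \<open>inverse_image f s s'\<close> says that \<open>s'\<close> represents the pullback of
  the subobject \<open>s\<close> along \<open>f\<close>, and a cover is an arrow whose image is the whole codomain.
\<close>

definition Sub :: "'o \<Rightarrow> 'm set" where
  "Sub X = {m. is_mono m \<and> Cod E m = X}"

definition sub_le :: "'m \<Rightarrow> 'm \<Rightarrow> bool" where
  "sub_le m n \<longleftrightarrow> (\<exists>k\<in>hom (Dom E m) (Dom E n). n \<cdot> k = m)"

definition inverse_image :: "'m \<Rightarrow> 'm \<Rightarrow> 'm \<Rightarrow> bool" where
  "inverse_image f s s' \<longleftrightarrow> s' \<in> Sub (Dom E f) \<and> (\<exists>q. is_pullback f s s' q)"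

definition is_image :: "'m \<Rightarrow> 'm \<Rightarrow> bool" where
  "is_image f m \<longleftrightarrow> m \<in> Sub (Cod E f) \<and> (\<exists>k\<in>hom (Dom E f) (Dom E m). m \<cdot> k = f) \<and>
    (\<forall>n\<in>Sub (Cod E f). (\<exists>k\<in>hom (Dom E f) (Dom E n). n \<cdot> k = f) \<longrightarrow> sub_le m n)"

definition is_cover :: "'m \<Rightarrow> bool" where
  "is_cover f \<longleftrightarrow> f \<in> Arr E \<and> is_image f (Id E (Cod E f))"

definition is_union :: "'o \<Rightarrow> 'm set \<Rightarrow> 'm \<Rightarrow> bool" where
  "is_union X S m \<longleftrightarrow> m \<in> Sub X \<and> (\<forall>s\<in>S. sub_le s m) \<and>
    (\<forall>n\<in>Sub X. (\<forall>s\<in>S. sub_le s n) \<longrightarrow> sub_le m n)"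

definition image_of :: "'m \<Rightarrow> 'm" where
  "image_of f = (SOME m. is_image f m)"

definition union_of :: "'o \<Rightarrow> 'm set \<Rightarrow> 'm" where
  "union_of X S = (SOME m. is_union X S m)"

end

locale category =
  fixes E :: "('o, 'm, 'e) cat_data_scheme" (structure)
  assumes Dom_Obj: "f \<in> Arr E \<Longrightarrow> Dom E f \<in> Obj E"
    and Cod_Obj: "f \<in> Arr E \<Longrightarrow> Cod E f \<in> Obj E"
    and Id_hom: "X \<in> Obj E \<Longrightarrow> Id E X \<in> hom E X X"
    and Comp_hom: "f \<in> hom E X Y \<Longrightarrow> g \<in> hom E Y Z \<Longrightarrow> g \<cdot> f \<in> hom E X Z"
    and Comp_Id: "f \<in> hom E X Y \<Longrightarrow> f \<cdot> Id E X = f"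
    and Id_Comp: "f \<in> hom E X Y \<Longrightarrow> Id E Y \<cdot> f = f"
    and Comp_assoc: "f \<in> hom E W X \<Longrightarrow> g \<in> hom E X Y \<Longrightarrow> h \<in> hom E Y Z \<Longrightarrow>
      (h \<cdot> g) \<cdot> f = h \<cdot> (g \<cdot> f)"

locale finitely_complete = category E
  for E :: "('o, 'm, 'e) topos_data_scheme" (structure) +
  assumes One_Obj: "One E \<in> Obj E"
    and One_universal: "X \<in> Obj E \<Longrightarrow> \<exists>!f. f \<in> hom E X (One E)"
    and Prd_Obj: "X \<in> Obj E \<Longrightarrow> Y \<in> Obj E \<Longrightarrow> Prd E X Y \<in> Obj E"
    and Fst_hom: "X \<in> Obj E \<Longrightarrow> Y \<in> Obj E \<Longrightarrow> Fst E X Y \<in> hom E (Prd E X Y) X"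
    and Snd_hom: "X \<in> Obj E \<Longrightarrow> Y \<in> Obj E \<Longrightarrow> Snd E X Y \<in> hom E (Prd E X Y) Y"
    and Prd_universal: "f \<in> hom E Z X \<Longrightarrow> g \<in> hom E Z Y \<Longrightarrow>
      \<exists>!h. h \<in> hom E Z (Prd E X Y) \<and> Fst E X Y \<cdot> h = f \<and> Snd E X Y \<cdot> h = g"
    and Eql_hom: "f \<in> hom E X Y \<Longrightarrow> g \<in> hom E X Y \<Longrightarrow> Eql E f g \<in> hom E (Dom E (Eql E f g)) X"
    and Eql_eq: "f \<in> hom E X Y \<Longrightarrow> g \<in> hom E X Y \<Longrightarrow> f \<cdot> Eql E f g = g \<cdot> Eql E f g"
    and Eql_universal: "f \<in> hom E X Y \<Longrightarrow> g \<in> hom E X Y \<Longrightarrow> h \<in> hom E Z X \<Longrightarrow> f \<cdot> h = g \<cdot> h \<Longrightarrow>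
      \<exists>!k. k \<in> hom E Z (Dom E (Eql E f g)) \<and> Eql E f g \<cdot> k = h"

section \<open>Calculus of products and exponentials\<close>

context
  fixes E :: "('o, 'm, 'e) topos_data_scheme" (structure)
begin

definition bang :: "'o \<Rightarrow> 'm" where
  "bang X = (THE f. f \<in> hom E X (One E))"

definition pair :: "'m \<Rightarrow> 'm \<Rightarrow> 'm" where
  "pair f g = (THE h. h \<in> hom E (Dom E f) (Prd E (Cod E f) (Cod E g)) \<and>
    Fst E (Cod E f) (Cod E g) \<cdot> h = f \<and> Snd E (Cod E f) (Cod E g) \<cdot> h = g)"

definition factor :: "'m \<Rightarrow> 'm \<Rightarrow> 'm" where
  "factor m f = (THE k. k \<in> hom E (Dom E f) (Dom E m) \<and> m \<cdot> k = f)"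

definition uncurry :: "'o \<Rightarrow> 'o \<Rightarrow> 'o \<Rightarrow> 'm \<Rightarrow> 'm" where
  "uncurry Z N P g = Ev E N P \<cdot> pair (g \<cdot> Fst E Z N) (Snd E Z N)"

definition transpose :: "'o \<Rightarrow> 'o \<Rightarrow> 'o \<Rightarrow> 'm \<Rightarrow> 'm" where
  "transpose Z N P f = (THE g. g \<in> hom E Z (Exp E N P) \<and> uncurry Z N P g = f)"

definition proj1 :: "'o \<Rightarrow> 'o \<Rightarrow> 'o \<Rightarrow> 'm" where
  "proj1 X Y Z = Fst E X Y \<cdot> Fst E (Prd E X Y) Z"

definition proj2 :: "'o \<Rightarrow> 'o \<Rightarrow> 'o \<Rightarrow> 'm" where
  "proj2 X Y Z = Snd E X Y \<cdot> Fst E (Prd E X Y) Z"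

definition proj3 :: "'o \<Rightarrow> 'o \<Rightarrow> 'o \<Rightarrow> 'm" where
  "proj3 X Y Z = Snd E (Prd E X Y) Z"

end

locale topos = finitely_complete E
  for E :: "('o, 'm, 'e) topos_data_scheme" (structure) +
  assumes Exp_Obj: "N \<in> Obj E \<Longrightarrow> P \<in> Obj E \<Longrightarrow> Exp E N P \<in> Obj E"
    and Ev_hom: "N \<in> Obj E \<Longrightarrow> P \<in> Obj E \<Longrightarrow> Ev E N P \<in> hom E (Prd E (Exp E N P) N) P"
    and Exp_universal: "Z \<in> Obj E \<Longrightarrow> N \<in> Obj E \<Longrightarrow> P \<in> Obj E \<Longrightarrow> f \<in> hom E (Prd E Z N) P \<Longrightarrow>
      \<exists>!g. g \<in> hom E Z (Exp E N P) \<and> uncurry E Z N P g = f"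
    and Omega_Obj: "Omega E \<in> Obj E"
    and Tru_hom: "Tru E \<in> hom E (One E) (Omega E)"
    and Omega_universal: "m \<in> Sub E X \<Longrightarrow>
      \<exists>!c. c \<in> hom E X (Omega E) \<and> is_pullback E c (Tru E) m (bang E (Dom E m))"

text \<open>
  A geometric category is a regular category (images exist and covers are stable under pullback)
  whose subobject posets have arbitrary unions that are stable under pullback. Well-poweredness
  is automatic because the arrows form a set.
\<close>

locale regular_category = finitely_complete E
  for E :: "('o, 'm, 'e) topos_data_scheme" (structure) +
  assumes image_exists: "f \<in> Arr E \<Longrightarrow> \<exists>m. is_image E f m"
    and cover_stable: "is_cover E g \<Longrightarrow> is_pullback E f g p q \<Longrightarrow> is_cover E p"

locale geometric_category = regular_category E
  for E :: "('o, 'm, 'e) topos_data_scheme" (structure) +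
  assumes union_exists: "X \<in> Obj E \<Longrightarrow> S \<subseteq> Sub E X \<Longrightarrow> \<exists>m. is_union E X S m"
    and union_stable: "f \<in> hom E Y X \<Longrightarrow> S \<subseteq> Sub E X \<Longrightarrow> is_union E X S m \<Longrightarrow>
      inverse_image E f m m' \<Longrightarrow> is_union E Y {s'. \<exists>s\<in>S. inverse_image E f s s'} m'"

section \<open>Internal algebra\<close>

record ('o, 'm) abgrp =
  Car :: 'o
  Add :: 'm
  Zero :: 'm
  Neg :: 'm

record ('o, 'm) ringob = "('o, 'm) abgrp" +
  Mul :: 'm
  Unit :: 'm

record ('o, 'm) modob = "('o, 'm) abgrp" +
  Act :: 'm

context
  fixes E :: "('o, 'm, 'e) topos_data_scheme" (structure)
begin

definition abelian_group_object :: "('o, 'm, 'g) abgrp_scheme \<Rightarrow> bool" where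
  "abelian_group_object G \<longleftrightarrow> (let
      X = Car G; add = (\<lambda>f g. Add G \<cdot> pair E f g); zero = Zero G \<cdot> bang E X;
      u = proj1 E X X X; v = proj2 E X X X; w = proj3 E X X X
    in X \<in> Obj E \<and> Add G \<in> hom E (Prd E X X) X \<and> Zero G \<in> hom E (One E) X \<and> Neg G \<in> hom E X X \<and>
      add (add u v) w = add u (add v w) \<and>
      add (Fst E X X) (Snd E X X) = add (Snd E X X) (Fst E X X) \<and>
      add zero (Id E X) = Id E X \<and>
      add (Neg G) (Id E X) = zero)"

definition ring_object :: "('o, 'm, 'g) ringob_scheme \<Rightarrow> bool" where
  "ring_object A \<longleftrightarrow> (let
      X = Car A; add = (\<lambda>f g. Add A \<cdot> pair E f g); mul = (\<lambda>f g. Mul A \<cdot> pair E f g);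
      one = Unit A \<cdot> bang E X;
      u = proj1 E X X X; v = proj2 E X X X; w = proj3 E X X X
    in abelian_group_object A \<and> Mul A \<in> hom E (Prd E X X) X \<and> Unit A \<in> hom E (One E) X \<and>
      mul (mul u v) w = mul u (mul v w) \<and>
      mul one (Id E X) = Id E X \<and> mul (Id E X) one = Id E X \<and>
      mul u (add v w) = add (mul u v) (mul u w) \<and>
      mul (add u v) w = add (mul u w) (mul v w))"

definition right_module :: "('o, 'm) ringob \<Rightarrow> ('o, 'm) modob \<Rightarrow> bool" where
  "right_module A M \<longleftrightarrow> (let
      X = Car M; R = Car A; act = (\<lambda>f g. Act M \<cdot> pair E f g)
    in abelian_group_object M \<and> Act M \<in> hom E (Prd E X R) X \<and>
      (let x = proj1 E X X R; y = proj2 E X X R; a = proj3 E X X R in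
        act (Add M \<cdot> pair E x y) a = Add M \<cdot> pair E (act x a) (act y a)) \<and>
      (let x = proj1 E X R R; a = proj2 E X R R; b = proj3 E X R R in
        act x (Add A \<cdot> pair E a b) = Add M \<cdot> pair E (act x a) (act x b) \<and>
        act x (Mul A \<cdot> pair E a b) = act (act x a) b) \<and>
      act (Id E X) (Unit A \<cdot> bang E X) = Id E X)"

definition left_module :: "('o, 'm) ringob \<Rightarrow> ('o, 'm) modob \<Rightarrow> bool" where
  "left_module A N \<longleftrightarrow> (let
      X = Car N; R = Car A; act = (\<lambda>f g. Act N \<cdot> pair E f g)
    in abelian_group_object N \<and> Act N \<in> hom E (Prd E R X) X \<and>
      (let a = proj1 E R X X; x = proj2 E R X X; y = proj3 E R X X in
        act a (Add N \<cdot> pair E x y) = Add N \<cdot> pair E (act a x) (act a y)) \<and>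
      (let a = proj1 E R R X; b = proj2 E R R X; x = proj3 E R R X in
        act (Add A \<cdot> pair E a b) x = Add N \<cdot> pair E (act a x) (act b x) \<and>
        act (Mul A \<cdot> pair E a b) x = act a (act b x)) \<and>
      act (Unit A \<cdot> bang E X) (Id E X) = Id E X)"

definition HomZ :: "('o, 'm, 'g) abgrp_scheme \<Rightarrow> ('o, 'm, 'h) abgrp_scheme \<Rightarrow> 'm set" where
  "HomZ G H = {f \<in> hom E (Car G) (Car H).
    f \<cdot> Add G = Add H \<cdot> pair E (f \<cdot> Fst E (Car G) (Car G)) (f \<cdot> Snd E (Car G) (Car G))}"

definition HomA :: "('o, 'm) ringob \<Rightarrow> ('o, 'm) modob \<Rightarrow> ('o, 'm) modob \<Rightarrow> 'm set" where
  "HomA A M M' = {f \<in> HomZ M M'.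
    f \<cdot> Act M = Act M' \<cdot> pair E (f \<cdot> Fst E (Car M) (Car A)) (Snd E (Car M) (Car A))}"

text \<open>
  \<open>additive_maps N P\<close> is the inclusion of \<open>[N, P]\<^sub>Z\<close> into \<open>[N, P]\<close>: the locus of those \<open>f\<close> for
  which \<open>f (n + n') = f n + f n'\<close>, that is, the equaliser of the transposes of the two maps
  \<open>[N, P] \<times> (N \<times> N) \<rightarrow> P\<close> given by the two sides of this equation.
\<close>

definition additive_maps :: "('o, 'm, 'g) abgrp_scheme \<Rightarrow> ('o, 'm, 'h) abgrp_scheme \<Rightarrow> 'm" where
  "additive_maps N P = (let
      X = Car N; Y = Car P; F = Exp E X Y; XX = Prd E X X; f = Fst E F XX;
      n = Fst E X X \<cdot> Snd E F XX; n' = Snd E X X \<cdot> Snd E F XX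
    in Eql E
      (transpose E F XX Y (Ev E X Y \<cdot> pair E f (Add N \<cdot> pair E n n')))
      (transpose E F XX Y (Add P \<cdot> pair E (Ev E X Y \<cdot> pair E f n) (Ev E X Y \<cdot> pair E f n'))))"

text \<open>
  The element of \<open>[N, P]\<^sub>Z\<close> (with parameters in \<open>Z\<close>) whose values are given by an additive
  \<open>f : Z \<times> N \<rightarrow> P\<close>.
\<close>

definition additive_transpose ::
    "'o \<Rightarrow> ('o, 'm, 'g) abgrp_scheme \<Rightarrow> ('o, 'm, 'h) abgrp_scheme \<Rightarrow> 'm \<Rightarrow> 'm" where
  "additive_transpose Z N P f = factor E (additive_maps N P) (transpose E Z (Car N) (Car P) f)"

text \<open>
  \<open>[N, P]\<^sub>Z\<close> as a right module: the group structure is pointwise and \<open>(f a) n = f (a n)\<close>.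
\<close>

definition hom_module :: "('o, 'm) ringob \<Rightarrow> ('o, 'm) modob \<Rightarrow> ('o, 'm) abgrp \<Rightarrow> ('o, 'm) modob" where
  "hom_module A N P = (let
      i = additive_maps N P; H = Dom E i; X = Car N; R = Car A;
      app = (\<lambda>f n. Ev E X (Car P) \<cdot> pair E (i \<cdot> f) n)
    in \<lparr>Car = H,
      Add = additive_transpose (Prd E H H) N P
        (let f = proj1 E H H X; g = proj2 E H H X; n = proj3 E H H X in
          Add P \<cdot> pair E (app f n) (app g n)),
      Zero = additive_transpose (One E) N P (Zero P \<cdot> bang E (Prd E (One E) X)),
      Neg = additive_transpose H N P (Neg P \<cdot> app (Fst E H X) (Snd E H X)),
      Act = additive_transpose (Prd E H R) N P
        (let f = proj1 E H R X; a = proj2 E H R X; n = proj3 E H R X in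
          app f (Act N \<cdot> pair E a n))\<rparr>)"

text \<open>The map \<open>[N, P]\<^sub>Z \<rightarrow> [N, Q]\<^sub>Z\<close> given by composition with \<open>g : P \<rightarrow> Q\<close>.\<close>

definition hom_module_map ::
    "('o, 'm) modob \<Rightarrow> ('o, 'm) abgrp \<Rightarrow> ('o, 'm) abgrp \<Rightarrow> 'm \<Rightarrow> 'm" where
  "hom_module_map N P Q g = (let i = additive_maps N P; H = Dom E i in
    additive_transpose H N Q (g \<cdot> uncurry E H (Car N) (Car P) i))"

text \<open>
  \<open>T\<close> represents the functor \<open>P \<mapsto> Hom\<^sub>A (M, [N, P]\<^sub>Z)\<close> from \<open>Ab(E)\<close> to abelian groups, by the
  isomorphism \<open>\<Phi> P : Hom\<^sub>Z (T, P) \<rightarrow> Hom\<^sub>A (M, [N, P]\<^sub>Z)\<close> of abelian groups, natural in \<open>P\<close>.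
\<close>

definition represents_tensor :: "('o, 'm) ringob \<Rightarrow> ('o, 'm) modob \<Rightarrow> ('o, 'm) modob \<Rightarrow>
    ('o, 'm) abgrp \<Rightarrow> (('o, 'm) abgrp \<Rightarrow> 'm \<Rightarrow> 'm) \<Rightarrow> bool" where
  "represents_tensor A M N T \<Phi> \<longleftrightarrow> abelian_group_object T \<and>
    (\<forall>P. abelian_group_object P \<longrightarrow>
      bij_betw (\<Phi> P) (HomZ T P) (HomA A M (hom_module A N P)) \<and>
      (\<forall>f\<in>HomZ T P. \<forall>g\<in>HomZ T P. \<Phi> P (Add P \<cdot> pair E f g) =
        Add (hom_module A N P) \<cdot> pair E (\<Phi> P f) (\<Phi> P g))) \<and>
    (\<forall>P Q. abelian_group_object P \<longrightarrow> abelian_group_object Q \<longrightarrow>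
      (\<forall>g\<in>HomZ P Q. \<forall>f\<in>HomZ T P. \<Phi> Q (g \<cdot> f) = hom_module_map N P Q g \<cdot> \<Phi> P f))"

text \<open>
  The arrow \<open>\<otimes> : M \<times> N \<rightarrow> T\<close>: the transpose of the unit \<open>\<Phi> T id : M \<rightarrow> [N, T]\<^sub>Z\<close> followed by
  the inclusion into \<open>[N, T]\<close>.
\<close>

definition tensor_map :: "('o, 'm) modob \<Rightarrow> ('o, 'm) modob \<Rightarrow> ('o, 'm) abgrp \<Rightarrow>
    (('o, 'm) abgrp \<Rightarrow> 'm \<Rightarrow> 'm) \<Rightarrow> 'm" where
  "tensor_map M N T \<Phi> =
    uncurry E (Car M) (Car N) (Car T) (additive_maps N T \<cdot> \<Phi> T (Id E (Car T)))"

end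

section \<open>Internal language\<close>

text \<open>
  The fragment of the internal language with equality, existential quantification over the
  objects of the topos, and countable disjunctions. Function symbols are arrows of the topos.
\<close>

datatype ('v, 'm) trm = Var 'v | Star | Tuple "('v, 'm) trm" "('v, 'm) trm" | App 'm "('v, 'm) trm"

datatype ('v, 'o, 'm) fm =
    Equal "('v, 'm) trm" "('v, 'm) trm"
  | Exists 'v 'o "('v, 'o, 'm) fm"
  | Disj "nat \<Rightarrow> ('v, 'o, 'm) fm"

text \<open>
  Terms and formulas are interpreted over an object \<open>X\<close> (the product of the types of the
  variables in context), where \<open>\<rho>\<close> assigns to each variable of the context its projection from
  \<open>X\<close>; the value of \<open>\<rho>\<close> at other variables is irrelevant. A term denotes an arrow out of \<open>X\<close>,
  a formula a subobject of \<open>X\<close>. Binding a variable of type \<open>B\<close> extends the context to \<open>X \<times> B\<close>.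
\<close>

context
  fixes E :: "('o, 'm, 'e) topos_data_scheme" (structure)
begin

primrec interp_trm :: "'o \<Rightarrow> ('v \<Rightarrow> 'm) \<Rightarrow> ('v, 'm) trm \<Rightarrow> 'm" where
  "interp_trm X \<rho> (Var v) = \<rho> v"
| "interp_trm X \<rho> Star = bang E X"
| "interp_trm X \<rho> (Tuple s t) = pair E (interp_trm X \<rho> s) (interp_trm X \<rho> t)"
| "interp_trm X \<rho> (App f t) = f \<cdot> interp_trm X \<rho> t"

primrec interp :: "('v, 'o, 'm) fm \<Rightarrow> 'o \<Rightarrow> ('v \<Rightarrow> 'm) \<Rightarrow> 'm" where
  "interp (Equal s t) X \<rho> = Eql E (interp_trm X \<rho> s) (interp_trm X \<rho> t)"
| "interp (Exists v B \<phi>) X \<rho> = image_of E (Fst E X B \<cdot>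
    interp \<phi> (Prd E X B) ((\<lambda>w. \<rho> w \<cdot> Fst E X B)(v := Snd E X B)))"
| "interp (Disj \<Psi>) X \<rho> = union_of E X (range (\<lambda>p. interp (\<Psi> p) X \<rho>))"

text \<open>
  For a formula whose only free variable is \<open>v\<close>, of type \<open>X\<close>: the subobject of \<open>X\<close> that it
  defines, and its validity, that is, that this is the greatest subobject of \<open>X\<close>.
\<close>

definition extent :: "'v \<Rightarrow> 'o \<Rightarrow> ('v, 'o, 'm) fm \<Rightarrow> 'm" where
  "extent v X \<phi> = interp \<phi> X ((\<lambda>_. undefined)(v := Id E X))"

definition valid :: "'v \<Rightarrow> 'o \<Rightarrow> ('v, 'o, 'm) fm \<Rightarrow> bool" where
  "valid v X \<phi> \<longleftrightarrow> extent v X \<phi> \<in> Sub E X \<and> sub_le E (Id E X) (extent v X \<phi>)"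

end

section \<open>The formula\<close>

datatype var = Xv | Mv nat | Nv nat

text \<open>\<open>tensor_sum T t p\<close> is the term \<open>m\<^sub>1 \<otimes> n\<^sub>1 + \<dots> + m\<^sub>p \<otimes> n\<^sub>p\<close>, where \<open>t\<close> is the arrow \<open>\<otimes>\<close>.\<close>

primrec tensor_sum :: "('o, 'm) abgrp \<Rightarrow> 'm \<Rightarrow> nat \<Rightarrow> (var, 'm) trm" where
  "tensor_sum T t 0 = App (Zero T) Star"
| "tensor_sum T t (Suc p) =
    App (Add T) (Tuple (tensor_sum T t p) (App t (Tuple (Var (Mv (Suc p))) (Var (Nv (Suc p))))))"

definition exists_list :: "(nat \<Rightarrow> 'v) \<Rightarrow> 'o \<Rightarrow> nat \<Rightarrow> ('v, 'o, 'm) fm \<Rightarrow> ('v, 'o, 'm) fm" where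
  "exists_list v B p \<phi> = foldr (\<lambda>i. Exists (v i) B) [1..<Suc p] \<phi>"

definition tensor_formula :: "('o, 'm) modob \<Rightarrow> ('o, 'm) modob \<Rightarrow> ('o, 'm) abgrp \<Rightarrow> 'm \<Rightarrow>
    (var, 'o, 'm) fm" where
  "tensor_formula M N T t = Disj (\<lambda>p.
    exists_list Mv (Car M) p (exists_list Nv (Car N) p (Equal (Var Xv) (tensor_sum T t p))))"

end

theory Submission
  imports Defs
begin

text \<open>
  Let \<open>s\<close> be the subobject of \<open>T = M \<otimes>\<^sub>A N\<close> defined by \<open>\<phi>\<close>. It is closed under the group operations
  and \<open>\<otimes>\<close> factors through it, so \<open>s\<close> is a subgroup \<open>G \<rightarrow> T\<close> and the unit \<open>M \<rightarrow> [N, T]\<^sub>Z\<close> lifts to an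
  \<open>A\<close>-linear map \<open>M \<rightarrow> [N, G]\<^sub>Z\<close>. The homomorphism \<open>T \<rightarrow> G\<close> that represents the lift is a section
  of the monomorphism \<open>s\<close>, which is therefore an isomorphism.
\<close>

section \<open>Calculus of arrows\<close>

text \<open>Images and unions make membership in s a local matter: a generalised element U
  \<rightarrow> T that factors through s need not be a sum of tensors over U, only after passing to
  a covering family. Adding two such elements directly would mean following covers through every
  quantifier and disjunction. Instead, s is characterised as the least subobject of T containing
  every generalised element that is literally a sum. Closure under an operation becomes a leastness
  argument: the elements whose result lies in s form a subobject, definable by means of \<Omega> and
  exponentials, and it suffices that this subobject contains all sums. The homomorphism h : T
  \<rightarrow> G is a section of s for the following reason. By naturality the representation sends
  s h to the lift of the unit followed by [N, s], which is the unit again. It sends the identity to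
  the unit as well, and it is injective.\<close>

context category
begin

lemma homD: "f \<in> hom E X Y \<Longrightarrow> f \<in> Arr E \<and> Dom E f = X \<and> Cod E f = Y"
  by (simp add: hom_def)

lemma hom_objs: "f \<in> hom E X Y \<Longrightarrow> X \<in> Obj E \<and> Y \<in> Obj E"
  using Dom_Obj Cod_Obj by (auto simp: hom_def)

declare Dom_Obj [simp] Cod_Obj [simp]

text \<open>Typing is phrased with \<open>Arr\<close>, \<open>Dom\<close> and \<open>Cod\<close>
  instead of \<open>hom\<close>: in the latter form the middle object of a composite does not occur
  in the conclusion, so rewriting could not instantiate it.\<close>

lemma comp_typing [simp]:
  assumes "f \<in> Arr E" "g \<in> Arr E" "Cod E f = Dom E g"
  shows "g \<cdot> f \<in> Arr E" "Dom E (g \<cdot> f) = Dom E f" "Cod E (g \<cdot> f) = Cod E g"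
  using Comp_hom [of f "Dom E f" "Dom E g" g "Cod E g"] assms by (auto simp: hom_def)

lemma comp_assoc [simp]:
  assumes "f \<in> Arr E" "g \<in> Arr E" "h \<in> Arr E" "Cod E f = Dom E g" "Cod E g = Dom E h"
  shows "(h \<cdot> g) \<cdot> f = h \<cdot> g \<cdot> f"
  using Comp_assoc [of f "Dom E f" "Dom E g" g "Dom E h" h "Cod E h"] assms by (auto simp: hom_def)

lemma Id_typing [simp]:
  assumes "X \<in> Obj E"
  shows "Id E X \<in> Arr E" "Dom E (Id E X) = X" "Cod E (Id E X) = X"
  using Id_hom [OF assms] by (auto simp: hom_def)

lemma comp_Id [simp]: "f \<in> Arr E \<Longrightarrow> Dom E f = X \<Longrightarrow> f \<cdot> Id E X = f"
  using Comp_Id [of f X "Cod E f"] by (auto simp: hom_def)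

lemma Id_comp [simp]: "f \<in> Arr E \<Longrightarrow> Cod E f = X \<Longrightarrow> Id E X \<cdot> f = f"
  using Id_Comp [of f "Dom E f" X] by (auto simp: hom_def)

lemma mono_cancel:
  assumes "m \<in> Sub E X" "f \<in> hom E Z (Dom E m)" "g \<in> hom E Z (Dom E m)" "m \<cdot> f = m \<cdot> g"
  shows "f = g"
  using assms unfolding Sub_def is_mono_def hom_def by auto

lemma Sub_Arr [simp]: "m \<in> Sub E X \<Longrightarrow> m \<in> Arr E" "m \<in> Sub E X \<Longrightarrow> Cod E m = X"
  unfolding Sub_def is_mono_def by auto

lemma sub_le_trans:
  assumes "sub_le E a m" "sub_le E m n" "n \<in> Arr E"
  shows "sub_le E a n"
proof -
  obtain k l where k: "k \<in> hom E (Dom E a) (Dom E m)" "m \<cdot> k = a"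
    and l: "l \<in> hom E (Dom E m) (Dom E n)" "n \<cdot> l = m"
    using assms(1,2) unfolding sub_le_def by blast
  have "l \<cdot> k \<in> hom E (Dom E a) (Dom E n)" using k l by (simp add: hom_def)
  moreover have "n \<cdot> l \<cdot> k = a"
    using k l assms(3) comp_assoc [of k l n] by (simp add: hom_def)
  ultimately show ?thesis unfolding sub_le_def by blast
qed

lemma sub_le_comp:
  assumes "sub_le E a m" "a \<in> Arr E" "m \<in> Arr E" "f \<in> Arr E" "Cod E f = Dom E a"
  shows "sub_le E (a \<cdot> f) m"
proof -
  obtain k where k: "k \<in> hom E (Dom E a) (Dom E m)" "m \<cdot> k = a"
    using assms(1) unfolding sub_le_def by blast
  have "m \<cdot> k \<cdot> f = a \<cdot> f" using k assms comp_assoc [of f k m] by (simp add: hom_def)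
  moreover have "k \<cdot> f \<in> hom E (Dom E (a \<cdot> f)) (Dom E m)" using k assms by (simp add: hom_def)
  ultimately show ?thesis unfolding sub_le_def by blast
qed

lemma sub_le_refl: "m \<in> Arr E \<Longrightarrow> sub_le E m m"
  unfolding sub_le_def by (rule bexI [of _ "Id E (Dom E m)"]) (auto simp: hom_def)

text \<open>From s k = 1 follows s (k s) = s, and s cancels, so k is a two-sided inverse. This leads
  from validity of a formula to the isomorphism with its extent.\<close>

lemma split_mono_iso:
  assumes "s \<in> Sub E X" "sub_le E (Id E X) s"
  shows "is_iso E s"
proof -
  have X: "X \<in> Obj E" using assms(1) Cod_Obj [of s] by simp
  obtain k where k: "k \<in> hom E X (Dom E s)" "s \<cdot> k = Id E X"
    using assms(2) X unfolding sub_le_def by auto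
  have "s \<cdot> k \<cdot> s = (s \<cdot> k) \<cdot> s" using homD [OF k(1)] assms(1) by simp
  also have "\<dots> = s \<cdot> Id E (Dom E s)" unfolding k(2) using assms(1) by simp
  finally have "k \<cdot> s = Id E (Dom E s)"
    by (rule mono_cancel [OF assms(1), rotated 2])
      (use homD [OF k(1)] assms(1) in \<open>simp_all add: hom_def\<close>)
  then have "k \<in> hom E (Cod E s) (Dom E s) \<and> k \<cdot> s = Id E (Dom E s) \<and> s \<cdot> k = Id E (Cod E s)"
    using k assms(1) by simp
  then show ?thesis using Sub_Arr(1) [OF assms(1)] unfolding is_iso_def by blast
qed

end

section \<open>Finite products and equalisers in terms of generalised elements\<close>

context finitely_complete
begin

declare One_Obj [simp] Prd_Obj [simp]

lemma bang_typing [simp]: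
  assumes "X \<in> Obj E"
  shows "bang E X \<in> Arr E" "Dom E (bang E X) = X" "Cod E (bang E X) = One E"
  using theI' [OF One_universal [OF assms]] unfolding bang_def by (auto simp: hom_def)

lemma bang_unique:
  assumes "f \<in> Arr E" "Cod E f = One E" "Dom E f = X"
  shows "f = bang E X"
  using One_universal [of X] assms Dom_Obj [of f] bang_typing [of X] unfolding hom_def by auto

lemma bang_comp [simp]:
  "f \<in> Arr E \<Longrightarrow> Cod E f = X \<Longrightarrow> bang E X \<cdot> f = bang E (Dom E f)"
  using Cod_Obj [of f] by (intro bang_unique) auto

lemma bang_One [simp]: "bang E (One E) = Id E (One E)"
  by (rule bang_unique [symmetric]) auto

lemma Fst_Snd_typing [simp]:
  assumes "X \<in> Obj E" "Y \<in> Obj E"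
  shows "Fst E X Y \<in> Arr E" "Dom E (Fst E X Y) = Prd E X Y" "Cod E (Fst E X Y) = X"
    "Snd E X Y \<in> Arr E" "Dom E (Snd E X Y) = Prd E X Y" "Cod E (Snd E X Y) = Y"
  using Fst_hom [OF assms] Snd_hom [OF assms] by (auto simp: hom_def)

lemma pair_props:
  assumes "f \<in> Arr E" "g \<in> Arr E" "Dom E f = Dom E g"
  shows "pair E f g \<in> hom E (Dom E f) (Prd E (Cod E f) (Cod E g)) \<and>
    Fst E (Cod E f) (Cod E g) \<cdot> pair E f g = f \<and> Snd E (Cod E f) (Cod E g) \<cdot> pair E f g = g"
  using theI' [OF Prd_universal [of f "Dom E f" "Cod E f" g "Cod E g"]] assms
  unfolding pair_def hom_def by simp

lemma pair_typing [simp]: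
  assumes "f \<in> Arr E" "g \<in> Arr E" "Dom E f = Dom E g"
  shows "pair E f g \<in> Arr E" "Dom E (pair E f g) = Dom E g"
    "Cod E (pair E f g) = Prd E (Cod E f) (Cod E g)"
  using pair_props [OF assms] assms by (auto simp: hom_def)

lemma Fst_pair [simp]:
  "f \<in> Arr E \<Longrightarrow> g \<in> Arr E \<Longrightarrow> Dom E f = Dom E g \<Longrightarrow> Cod E f = X \<Longrightarrow> Cod E g = Y \<Longrightarrow>
    Fst E X Y \<cdot> pair E f g = f"
  using pair_props by blast

lemma Snd_pair [simp]:
  "f \<in> Arr E \<Longrightarrow> g \<in> Arr E \<Longrightarrow> Dom E f = Dom E g \<Longrightarrow> Cod E f = X \<Longrightarrow> Cod E g = Y \<Longrightarrow>
    Snd E X Y \<cdot> pair E f g = g"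
  using pair_props by blast

lemma pair_ext:
  assumes "h \<in> Arr E" "Cod E h = Prd E X Y" "X \<in> Obj E" "Y \<in> Obj E"
  shows "pair E (Fst E X Y \<cdot> h) (Snd E X Y \<cdot> h) = h"
proof -
  have "\<exists>!k. k \<in> hom E (Dom E h) (Prd E X Y) \<and> Fst E X Y \<cdot> k = Fst E X Y \<cdot> h \<and>
    Snd E X Y \<cdot> k = Snd E X Y \<cdot> h"
    by (rule Prd_universal) (use assms in \<open>auto simp: hom_def\<close>)
  moreover have "h \<in> hom E (Dom E h) (Prd E X Y)"
    "pair E (Fst E X Y \<cdot> h) (Snd E X Y \<cdot> h) \<in> hom E (Dom E h) (Prd E X Y)"
    using assms by (auto simp: hom_def)
  moreover have "Fst E X Y \<cdot> pair E (Fst E X Y \<cdot> h) (Snd E X Y \<cdot> h) = Fst E X Y \<cdot> h"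
    "Snd E X Y \<cdot> pair E (Fst E X Y \<cdot> h) (Snd E X Y \<cdot> h) = Snd E X Y \<cdot> h"
    using assms by simp_all
  ultimately show ?thesis by blast
qed

lemma pair_Fst_Snd [simp]:
  "X \<in> Obj E \<Longrightarrow> Y \<in> Obj E \<Longrightarrow> pair E (Fst E X Y) (Snd E X Y) = Id E (Prd E X Y)"
  using pair_ext [of "Id E (Prd E X Y)" X Y] by simp

text \<open>Substitutions are pushed inside tuples. With composites nested to the right this gives
  the normal form in which \<open>simp\<close> compares expressions in generalised elements.\<close>

lemma pair_comp [simp]:
  assumes "f \<in> Arr E" "g \<in> Arr E" "Dom E f = Dom E g" "h \<in> Arr E" "Cod E h = Dom E g"
  shows "pair E f g \<cdot> h = pair E (f \<cdot> h) (g \<cdot> h)"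
proof -
  have "Fst E (Cod E f) (Cod E g) \<cdot> pair E f g \<cdot> h = f \<cdot> h"
    "Snd E (Cod E f) (Cod E g) \<cdot> pair E f g \<cdot> h = g \<cdot> h"
    using assms comp_assoc [of h "pair E f g" "Fst E (Cod E f) (Cod E g)"]
      comp_assoc [of h "pair E f g" "Snd E (Cod E f) (Cod E g)"] by simp_all
  then show ?thesis
    using assms pair_ext [of "pair E f g \<cdot> h" "Cod E f" "Cod E g"] by simp
qed

text \<open>If e a = e b for the equaliser arrow e, then a and b are factorisations of one arrow
  through e, and such factorisations are unique.\<close>

lemma Eql_Sub:
  assumes "f \<in> hom E X Y" "g \<in> hom E X Y"
  shows "Eql E f g \<in> Sub E X"
proof -
  let ?e = "Eql E f g"
  have e: "?e \<in> Arr E" "Cod E ?e = X" using Eql_hom [OF assms] by (auto simp: hom_def)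
  have "a = b" if "a \<in> Arr E" "b \<in> Arr E" "Dom E a = Dom E b" "Cod E a = Dom E ?e"
    "Cod E b = Dom E ?e" "?e \<cdot> a = ?e \<cdot> b" for a b
  proof -
    have "f \<cdot> ?e \<cdot> a = g \<cdot> ?e \<cdot> a"
      using that e assms Eql_eq [OF assms] comp_assoc [of a ?e f] comp_assoc [of a ?e g]
      by (simp add: hom_def)
    then have "\<exists>!k. k \<in> hom E (Dom E a) (Dom E ?e) \<and> ?e \<cdot> k = ?e \<cdot> a"
      using that e by (intro Eql_universal [OF assms]) (auto simp: hom_def)
    then show ?thesis using that by (auto simp: hom_def)
  qed
  then show ?thesis using e unfolding Sub_def is_mono_def by blast
qed

text \<open>All equationally defined subobjects below are used in this form: additive maps,
  preimages, universal quantification and the interpretation of \<open>Equal\<close>.\<close>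

lemma Eql_sub_le:
  assumes "f \<in> hom E X Y" "g \<in> hom E X Y" "a \<in> hom E Z X"
  shows "sub_le E a (Eql E f g) \<longleftrightarrow> f \<cdot> a = g \<cdot> a"
proof
  let ?e = "Eql E f g"
  have e: "?e \<in> Arr E" "Cod E ?e = X" using Eql_hom [OF assms(1,2)] by (auto simp: hom_def)
  { assume "sub_le E a ?e"
    then obtain k where k: "k \<in> hom E Z (Dom E ?e)" "?e \<cdot> k = a"
      using assms unfolding sub_le_def hom_def by auto
    then have "f \<cdot> ?e \<cdot> k = g \<cdot> ?e \<cdot> k"
      using e assms Eql_eq [OF assms(1,2)] comp_assoc [of k ?e f] comp_assoc [of k ?e g]
      by (simp add: hom_def)
    then show "f \<cdot> a = g \<cdot> a" using k by simp }
  assume "f \<cdot> a = g \<cdot> a"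
  from ex1_implies_ex [OF Eql_universal [OF assms this]] show "sub_le E a ?e"
    using homD [OF assms(3)] unfolding sub_le_def by auto
qed

end

section \<open>Exponentials and the subobject classifier in terms of generalised elements\<close>

context topos
begin

declare Exp_Obj [simp] Omega_Obj [simp]

lemma Ev_typing [simp]:
  assumes "N \<in> Obj E" "P \<in> Obj E"
  shows "Ev E N P \<in> Arr E" "Dom E (Ev E N P) = Prd E (Exp E N P) N" "Cod E (Ev E N P) = P"
  using Ev_hom [OF assms] by (auto simp: hom_def)

lemma Tru_typing [simp]: "Tru E \<in> Arr E" "Dom E (Tru E) = One E" "Cod E (Tru E) = Omega E"
  using Tru_hom by (auto simp: hom_def)

lemma transpose_props:
  assumes "f \<in> hom E (Prd E Z N) P" "Z \<in> Obj E" "N \<in> Obj E"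
  shows "transpose E Z N P f \<in> hom E Z (Exp E N P) \<and> uncurry E Z N P (transpose E Z N P f) = f"
proof -
  have "P \<in> Obj E" using assms(1) Cod_Obj by (auto simp: hom_def)
  then show ?thesis
    unfolding transpose_def using theI' [OF Exp_universal [OF assms(2,3) _ assms(1)]] by blast
qed

lemma transpose_typing [simp]:
  assumes "f \<in> Arr E" "Dom E f = Prd E Z N" "Cod E f = P" "Z \<in> Obj E" "N \<in> Obj E"
  shows "transpose E Z N P f \<in> Arr E" "Dom E (transpose E Z N P f) = Z"
    "Cod E (transpose E Z N P f) = Exp E N P"
  using transpose_props [of f Z N P] assms by (auto simp: hom_def)

text \<open>The beta rule precomposed with an arbitrary pair, which is the shape that remains once
  substitutions have been pushed inside tuples.\<close>

lemma Ev_transpose [simp]: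
  assumes "f \<in> Arr E" "Dom E f = Prd E Z N" "Cod E f = P" "Z \<in> Obj E" "N \<in> Obj E"
    and "a \<in> Arr E" "b \<in> Arr E" "Dom E a = Dom E b" "Cod E a = Z" "Cod E b = N"
  shows "Ev E N P \<cdot> pair E (transpose E Z N P f \<cdot> a) b = f \<cdot> pair E a b"
proof -
  have P: "P \<in> Obj E" using assms(1,3) Cod_Obj by auto
  have "f \<cdot> pair E a b = uncurry E Z N P (transpose E Z N P f) \<cdot> pair E a b"
    using transpose_props [of f Z N P] assms by (simp add: hom_def)
  also have "\<dots> = Ev E N P \<cdot> pair E (transpose E Z N P f \<cdot> a) b"
    unfolding uncurry_def using assms P by simp
  finally show ?thesis by simp
qed

text \<open>Uniqueness of transposes, read as extensionality: it is enough to compare values at the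
  generic element of N, the second projection of Z \<times> N.\<close>

lemma Exp_ext:
  assumes "f \<in> hom E Z (Exp E N P)" "g \<in> hom E Z (Exp E N P)" "N \<in> Obj E" "P \<in> Obj E"
    and "Ev E N P \<cdot> pair E (f \<cdot> Fst E Z N) (Snd E Z N) = Ev E N P \<cdot> pair E (g \<cdot> Fst E Z N) (Snd E Z N)"
  shows "f = g"
proof -
  have Z: "Z \<in> Obj E" using assms(1) Dom_Obj by (auto simp: hom_def)
  have "uncurry E Z N P g \<in> hom E (Prd E Z N) P"
    unfolding uncurry_def using assms Z by (simp add: hom_def)
  from Exp_universal [OF Z assms(3,4) this] show ?thesis
    using assms unfolding uncurry_def by auto
qed

text \<open>The pullback square of the classifying arrow turns membership into an equation.
  Equations can be pulled back and transposed, so preimages and universal quantifiers become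
  equalisers.\<close>

lemma classifier:
  assumes "s \<in> Sub E X"
  obtains c where "c \<in> hom E X (Omega E)"
    "\<And>a. a \<in> Arr E \<Longrightarrow> Cod E a = X \<Longrightarrow> sub_le E a s \<longleftrightarrow> c \<cdot> a = Tru E \<cdot> bang E (Dom E a)"
proof -
  obtain c where c: "c \<in> hom E X (Omega E)" and pb: "is_pullback E c (Tru E) s (bang E (Dom E s))"
    using Omega_universal [OF assms] by blast
  have "sub_le E a s \<longleftrightarrow> c \<cdot> a = Tru E \<cdot> bang E (Dom E a)" if a: "a \<in> Arr E" "Cod E a = X" for a
  proof
    assume "sub_le E a s"
    then obtain k where k: "k \<in> hom E (Dom E a) (Dom E s)" "s \<cdot> k = a"
      unfolding sub_le_def by blast
    have "c \<cdot> s \<cdot> k = (Tru E \<cdot> bang E (Dom E s)) \<cdot> k"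
      using pb k c assms comp_assoc [of k s c] unfolding is_pullback_def by (simp add: hom_def)
    then show "c \<cdot> a = Tru E \<cdot> bang E (Dom E a)" using k assms by (simp add: hom_def)
  next
    assume "c \<cdot> a = Tru E \<cdot> bang E (Dom E a)"
    then show "sub_le E a s"
      using pb a c assms unfolding is_pullback_def sub_le_def
      by (simp add: hom_def) (metis bang_typing Dom_Obj)
  qed
  then show thesis using that c by blast
qed

text \<open>For the classifying arrow c of s, the equaliser of c f with constant truth is the
  preimage.\<close>

lemma preimage_exists:
  assumes "s \<in> Sub E Y" "f \<in> hom E X Y"
  obtains n where "n \<in> Sub E X"
    "\<And>U a. a \<in> hom E U X \<Longrightarrow> sub_le E a n \<longleftrightarrow> sub_le E (f \<cdot> a) s"
proof -
  obtain c where c: "c \<in> hom E Y (Omega E)"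
    "\<And>a. a \<in> Arr E \<Longrightarrow> Cod E a = Y \<Longrightarrow> sub_le E a s \<longleftrightarrow> c \<cdot> a = Tru E \<cdot> bang E (Dom E a)"
    using classifier [OF assms(1)] by metis
  have X: "X \<in> Obj E" using assms(2) by (auto simp: hom_def)
  have h: "c \<cdot> f \<in> hom E X (Omega E)" "Tru E \<cdot> bang E X \<in> hom E X (Omega E)"
    using c assms X by (auto simp: hom_def)
  show thesis
    by (rule that [OF Eql_Sub [OF h]], subst Eql_sub_le [OF h])
      (use c assms X in \<open>auto simp: hom_def\<close>)
qed

text \<open>The subobject \<open>{x | \<forall>u. f (x, u) \<in> s}\<close>, cut out in \<open>X\<close> by an equation in \<open>\<Omega>\<^sup>U\<close>.\<close>

lemma forall_exists:
  assumes "s \<in> Sub E Y" "f \<in> hom E (Prd E X U) Y" "X \<in> Obj E" "U \<in> Obj E"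
  obtains n where "n \<in> Sub E X"
    "\<And>V a. a \<in> hom E V X \<Longrightarrow>
      sub_le E a n \<longleftrightarrow> sub_le E (f \<cdot> pair E (a \<cdot> Fst E V U) (Snd E V U)) s"
proof -
  obtain c where c: "c \<in> hom E Y (Omega E)"
    "\<And>a. a \<in> Arr E \<Longrightarrow> Cod E a = Y \<Longrightarrow> sub_le E a s \<longleftrightarrow> c \<cdot> a = Tru E \<cdot> bang E (Dom E a)"
    using classifier [OF assms(1)] by metis
  let ?l = "transpose E X U (Omega E) (c \<cdot> f)"
  let ?r = "transpose E X U (Omega E) (Tru E \<cdot> bang E (Prd E X U))"
  have h: "?l \<in> hom E X (Exp E U (Omega E))" "?r \<in> hom E X (Exp E U (Omega E))"
    using c assms by (auto simp: hom_def)
  have "?l \<cdot> a = ?r \<cdot> a \<longleftrightarrow> sub_le E (f \<cdot> pair E (a \<cdot> Fst E V U) (Snd E V U)) s"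
    if a: "a \<in> hom E V X" for V a
  proof -
    have V: "V \<in> Obj E" using a by (auto simp: hom_def)
    have la: "?l \<cdot> a \<in> hom E V (Exp E U (Omega E))" "?r \<cdot> a \<in> hom E V (Exp E U (Omega E))"
      using Comp_hom [OF a] h by blast+
    \<comment> \<open>Elements of \<Omega>^U agree as soon as their values at the generic u agree;
      by the beta rule these values are c (f (a, u)) and truth.\<close>
    have "?l \<cdot> a = ?r \<cdot> a \<longleftrightarrow>
      Ev E U (Omega E) \<cdot> pair E ((?l \<cdot> a) \<cdot> Fst E V U) (Snd E V U) =
      Ev E U (Omega E) \<cdot> pair E ((?r \<cdot> a) \<cdot> Fst E V U) (Snd E V U)"
      using Exp_ext [OF la assms(4) Omega_Obj] by metis
    also have "\<dots> \<longleftrightarrow> sub_le E (f \<cdot> pair E (a \<cdot> Fst E V U) (Snd E V U)) s"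
      using homD [OF a] homD [OF c(1)] homD [OF assms(2)] V assms(3,4) c(2) by simp
    finally show ?thesis .
  qed
  then show thesis
    using that [OF Eql_Sub [OF h]] Eql_sub_le [OF h] by presburger
qed

end


section \<open>Abelian group objects and internal homs\<close>

context finitely_complete
begin

abbreviation (input) gadd :: "('o, 'm, 'g) abgrp_scheme \<Rightarrow> 'm \<Rightarrow> 'm \<Rightarrow> 'm" where
  "gadd G f g \<equiv> Add G \<cdot> pair E f g"

lemma abgrp_typing:
  assumes "abelian_group_object E G"
  shows "Car G \<in> Obj E" "Add G \<in> Arr E" "Dom E (Add G) = Prd E (Car G) (Car G)"
    "Cod E (Add G) = Car G" "Zero G \<in> Arr E" "Dom E (Zero G) = One E" "Cod E (Zero G) = Car G"
    "Neg G \<in> Arr E" "Dom E (Neg G) = Car G" "Cod E (Neg G) = Car G"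
  using assms unfolding abelian_group_object_def Let_def hom_def by auto

context
  fixes G :: "('o, 'm, 'g) abgrp_scheme"
  assumes G: "abelian_group_object E G"
begin

lemmas [simp] = abgrp_typing [OF G]

lemma gadd_hom: "f \<in> hom E U (Car G) \<Longrightarrow> g \<in> hom E U (Car G) \<Longrightarrow> gadd G f g \<in> hom E U (Car G)"
  by (simp add: hom_def)

text \<open>The axiom is an equation of arrows out of the triple product; precomposing with the
  tuple ((f, g), h) gives the law for generalised elements. The other three axioms are transferred
  likewise.\<close>

lemma gadd_assoc:
  assumes "f \<in> hom E U (Car G)" "g \<in> hom E U (Car G)" "h \<in> hom E U (Car G)"
  shows "gadd G (gadd G f g) h = gadd G f (gadd G g h)"
proof -
  let ?X = "Car G"
  have "gadd G (gadd G (proj1 E ?X ?X ?X) (proj2 E ?X ?X ?X)) (proj3 E ?X ?X ?X) =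
    gadd G (proj1 E ?X ?X ?X) (gadd G (proj2 E ?X ?X ?X) (proj3 E ?X ?X ?X))"
    using G unfolding abelian_group_object_def Let_def by blast
  from arg_cong [OF this, of "\<lambda>k. k \<cdot> pair E (pair E f g) h"] show ?thesis
    using homD [OF assms(1)] homD [OF assms(2)] homD [OF assms(3)]
    by (simp add: proj1_def proj2_def proj3_def)
qed

lemma gadd_commute:
  assumes "f \<in> hom E U (Car G)" "g \<in> hom E U (Car G)"
  shows "gadd G f g = gadd G g f"
proof -
  let ?X = "Car G"
  have "gadd G (Fst E ?X ?X) (Snd E ?X ?X) = gadd G (Snd E ?X ?X) (Fst E ?X ?X)"
    using G unfolding abelian_group_object_def Let_def by blast
  from arg_cong [OF this, of "\<lambda>k. k \<cdot> pair E f g"] show ?thesis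
    using homD [OF assms(1)] homD [OF assms(2)] by simp
qed

lemma gadd_zero:
  assumes "f \<in> hom E U (Car G)"
  shows "gadd G (Zero G \<cdot> bang E U) f = f"
proof -
  have "gadd G (Zero G \<cdot> bang E (Car G)) (Id E (Car G)) = Id E (Car G)"
    using G unfolding abelian_group_object_def Let_def by blast
  from arg_cong [OF this, of "\<lambda>k. k \<cdot> f"] show ?thesis
    using homD [OF assms] by simp
qed

lemma gadd_neg:
  assumes "f \<in> hom E U (Car G)"
  shows "gadd G (Neg G \<cdot> f) f = Zero G \<cdot> bang E U"
proof -
  have "gadd G (Neg G) (Id E (Car G)) = Zero G \<cdot> bang E (Car G)"
    using G unfolding abelian_group_object_def Let_def by blast
  from arg_cong [OF this, of "\<lambda>k. k \<cdot> f"] show ?thesis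
    using homD [OF assms] by simp
qed

lemma gadd_left_cancel:
  assumes f: "f \<in> hom E U (Car G)" and g: "g \<in> hom E U (Car G)" and h: "h \<in> hom E U (Car G)"
    and eq: "gadd G f g = gadd G f h"
  shows "g = h"
proof -
  have nf: "Neg G \<cdot> f \<in> hom E U (Car G)" using f by (simp add: hom_def)
  have "gadd G (gadd G (Neg G \<cdot> f) f) g = gadd G (gadd G (Neg G \<cdot> f) f) h"
    unfolding gadd_assoc [OF nf f g] gadd_assoc [OF nf f h] eq ..
  then show ?thesis unfolding gadd_neg [OF f] gadd_zero [OF g] gadd_zero [OF h] .
qed

text \<open>Because of this exchange of the two middle terms, a pointwise sum of additive maps is
  additive.\<close>

lemma gadd_interchange:
  assumes a: "a \<in> hom E U (Car G)" and b: "b \<in> hom E U (Car G)"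
    and c: "c \<in> hom E U (Car G)" and d: "d \<in> hom E U (Car G)"
  shows "gadd G (gadd G a b) (gadd G c d) = gadd G (gadd G a c) (gadd G b d)"
  unfolding gadd_assoc [OF a b gadd_hom [OF c d]] gadd_assoc [OF a c gadd_hom [OF b d]]
  using gadd_assoc [OF b c d] gadd_assoc [OF c b d] gadd_commute [OF b c] by simp

lemma neg_unique:
  assumes f: "f \<in> hom E U (Car G)" and g: "g \<in> hom E U (Car G)"
    and eq: "gadd G g f = Zero G \<cdot> bang E U"
  shows "Neg G \<cdot> f = g"
proof -
  have nf: "Neg G \<cdot> f \<in> hom E U (Car G)" using f by (simp add: hom_def)
  show ?thesis
    using gadd_left_cancel [OF f nf g] gadd_neg [OF f] eq gadd_commute [OF f nf]
      gadd_commute [OF f g] by simp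
qed

text \<open>Cancel f in f + f = f + 0. The tensor is only known to respect sums; that 0 \<otimes> n
  vanishes is obtained from here.\<close>

lemma idem_is_zero:
  assumes f: "f \<in> hom E U (Car G)" and eq: "gadd G f f = f"
  shows "f = Zero G \<cdot> bang E U"
proof -
  have z: "Zero G \<cdot> bang E U \<in> hom E U (Car G)" using hom_objs [OF f] by (simp add: hom_def)
  show ?thesis
    by (rule gadd_left_cancel [OF f f z])
      (use eq gadd_zero [OF f] gadd_commute [OF f z] in simp)
qed

lemma neg_zero:
  assumes U: "U \<in> Obj E"
  shows "Neg G \<cdot> Zero G \<cdot> bang E U = Zero G \<cdot> bang E U"
proof -
  have z: "Zero G \<cdot> bang E U \<in> hom E U (Car G)" using U by (simp add: hom_def)
  show ?thesis by (rule neg_unique [OF z z gadd_zero [OF z]])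
qed

lemma neg_gadd:
  assumes f: "f \<in> hom E U (Car G)" and g: "g \<in> hom E U (Car G)"
  shows "Neg G \<cdot> gadd G f g = gadd G (Neg G \<cdot> f) (Neg G \<cdot> g)"
proof -
  have n: "Neg G \<cdot> f \<in> hom E U (Car G)" "Neg G \<cdot> g \<in> hom E U (Car G)"
    using f g by (simp_all add: hom_def)
  have z: "Zero G \<cdot> bang E U \<in> hom E U (Car G)" using hom_objs [OF f] by (simp add: hom_def)
  show ?thesis
    by (rule neg_unique [OF gadd_hom [OF f g] gadd_hom [OF n]])
      (simp only: gadd_interchange [OF n f g] gadd_neg [OF f] gadd_neg [OF g] gadd_zero [OF z])
qed

end

lemma HomZ_gadd:
  assumes "abelian_group_object E G" "abelian_group_object E H" "\<phi> \<in> HomZ E G H"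
    and "f \<in> hom E U (Car G)" "g \<in> hom E U (Car G)"
  shows "\<phi> \<cdot> gadd G f g = gadd H (\<phi> \<cdot> f) (\<phi> \<cdot> g)"
proof -
  note [simp] = abgrp_typing [OF assms(1)] abgrp_typing [OF assms(2)]
  have h: "\<phi> \<in> hom E (Car G) (Car H)" and
    eq: "\<phi> \<cdot> Add G = gadd H (\<phi> \<cdot> Fst E (Car G) (Car G)) (\<phi> \<cdot> Snd E (Car G) (Car G))"
    using assms(3) unfolding HomZ_def by auto
  have "(\<phi> \<cdot> Add G) \<cdot> pair E f g = gadd H (\<phi> \<cdot> f) (\<phi> \<cdot> g)"
    unfolding eq using homD [OF h] homD [OF assms(4)] homD [OF assms(5)] by simp
  then show ?thesis using homD [OF h] homD [OF assms(4)] homD [OF assms(5)] by simp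
qed

lemma HomZ_I:
  assumes G: "abelian_group_object E G" and H: "abelian_group_object E H"
    and h: "\<phi> \<in> hom E (Car G) (Car H)"
    and add: "\<And>U f g. f \<in> hom E U (Car G) \<Longrightarrow> g \<in> hom E U (Car G) \<Longrightarrow>
      \<phi> \<cdot> gadd G f g = gadd H (\<phi> \<cdot> f) (\<phi> \<cdot> g)"
  shows "\<phi> \<in> HomZ E G H"
  unfolding HomZ_def
  using h add [of "Fst E (Car G) (Car G)" _ "Snd E (Car G) (Car G)"] abgrp_typing [OF G]
  by (simp add: hom_def)

text \<open>Each of the three inclusions supplies a factorisation through s, and these
  factorisations are the operations of G. After composition with s the two sides of an axiom of G
  become an instance of the axiom of T, and s cancels.\<close>

lemma subgroup_object:
  assumes T: "abelian_group_object E T" and s: "s \<in> Sub E (Car T)"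
    and zero: "sub_le E (Zero T) s" and neg: "sub_le E (Neg T \<cdot> s) s"
    and add: "sub_le E (gadd T (s \<cdot> Fst E (Dom E s) (Dom E s)) (s \<cdot> Snd E (Dom E s) (Dom E s))) s"
  obtains G :: "('o, 'm) abgrp"
  where "abelian_group_object E G" "Car G = Dom E s" "s \<in> HomZ E G T"
proof -
  let ?X = "Dom E s"
  note tT [simp] = abgrp_typing [OF T]
  note sS [simp] = Sub_Arr [OF s]
  obtain ze where ze: "ze \<in> hom E (One E) ?X" "s \<cdot> ze = Zero T"
    using zero unfolding sub_le_def by auto
  obtain ne where ne: "ne \<in> hom E ?X ?X" "s \<cdot> ne = Neg T \<cdot> s"
    using neg unfolding sub_le_def by auto
  obtain ad where ad: "ad \<in> hom E (Prd E ?X ?X) ?X"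
    "s \<cdot> ad = gadd T (s \<cdot> Fst E ?X ?X) (s \<cdot> Snd E ?X ?X)"
    using add unfolding sub_le_def by auto
  note ty [simp] = homD [OF ze(1)] homD [OF ne(1)] homD [OF ad(1)]
  have s_ad: "s \<cdot> ad \<cdot> pair E f g = gadd T (s \<cdot> f) (s \<cdot> g)"
    if "f \<in> Arr E" "g \<in> Arr E" "Dom E f = Dom E g" "Cod E f = ?X" "Cod E g = ?X" for f g
  proof -
    have "s \<cdot> ad \<cdot> pair E f g = (s \<cdot> ad) \<cdot> pair E f g" using that by simp
    also have "\<dots> = gadd T (s \<cdot> f) (s \<cdot> g)" unfolding ad(2) using that by simp
    finally show ?thesis .
  qed
  have s_ze: "s \<cdot> ze \<cdot> f = Zero T \<cdot> f" if "f \<in> Arr E" "Cod E f = One E" for f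
    using that comp_assoc [of f ze s] ze(2) by simp
  have s_ne: "s \<cdot> ne \<cdot> f = Neg T \<cdot> s \<cdot> f" if "f \<in> Arr E" "Cod E f = ?X" for f
    using that comp_assoc [of f ne s] comp_assoc [of f s "Neg T"] ne(2) by simp
  have eqI: "f = g" if "f \<in> Arr E" "g \<in> Arr E" "Dom E f = Dom E g" "Cod E f = ?X" "Cod E g = ?X"
    "s \<cdot> f = s \<cdot> g" for f g
    using mono_cancel [OF s, of f "Dom E f" g] that by (simp add: hom_def)
  let ?G = "\<lparr>Car = ?X, Add = ad, Zero = ze, Neg = ne\<rparr>"
  let ?u = "proj1 E ?X ?X ?X" and ?v = "proj2 E ?X ?X ?X" and ?w = "proj3 E ?X ?X ?X"
  note P [simp] = proj1_def proj2_def proj3_def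
  have h: "s \<cdot> ?u \<in> hom E (Prd E (Prd E ?X ?X) ?X) (Car T)"
    "s \<cdot> ?v \<in> hom E (Prd E (Prd E ?X ?X) ?X) (Car T)"
    "s \<cdot> ?w \<in> hom E (Prd E (Prd E ?X ?X) ?X) (Car T)"
    "s \<cdot> Fst E ?X ?X \<in> hom E (Prd E ?X ?X) (Car T)" "s \<cdot> Snd E ?X ?X \<in> hom E (Prd E ?X ?X) (Car T)"
    "s \<in> hom E ?X (Car T)"
    by (simp_all add: hom_def)
  have 1: "ad \<cdot> pair E (ad \<cdot> pair E ?u ?v) ?w = ad \<cdot> pair E ?u (ad \<cdot> pair E ?v ?w)"
    by (rule eqI) (use gadd_assoc [OF T h(1,2,3)] in \<open>simp_all add: s_ad\<close>)
  have 2: "ad \<cdot> pair E (Fst E ?X ?X) (Snd E ?X ?X) = ad \<cdot> pair E (Snd E ?X ?X) (Fst E ?X ?X)"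
  proof (rule eqI)
    have "s \<cdot> ad \<cdot> pair E (Fst E ?X ?X) (Snd E ?X ?X) =
      gadd T (s \<cdot> Fst E ?X ?X) (s \<cdot> Snd E ?X ?X)" by (rule s_ad) simp_all
    also have "\<dots> = s \<cdot> ad \<cdot> pair E (Snd E ?X ?X) (Fst E ?X ?X)"
      using s_ad [of "Snd E ?X ?X" "Fst E ?X ?X"] gadd_commute [OF T h(4,5)] by simp
    finally show "s \<cdot> ad \<cdot> pair E (Fst E ?X ?X) (Snd E ?X ?X) =
      s \<cdot> ad \<cdot> pair E (Snd E ?X ?X) (Fst E ?X ?X)" .
  qed simp_all
  have 3: "ad \<cdot> pair E (ze \<cdot> bang E ?X) (Id E ?X) = Id E ?X"
    by (rule eqI) (use gadd_zero [OF T h(6)] in \<open>simp_all add: s_ad s_ze\<close>)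
  have 4: "ad \<cdot> pair E ne (Id E ?X) = ze \<cdot> bang E ?X"
    by (rule eqI) (use gadd_neg [OF T h(6)] ne(2) in \<open>simp_all add: s_ad s_ze\<close>)
  have G: "abelian_group_object E ?G"
    unfolding abelian_group_object_def Let_def abgrp.simps
    using 1 2 3 4 ze(1) ne(1) ad(1) Dom_Obj [OF sS(1)] by blast
  show thesis
    by (rule that [OF G]) (use ad(2) in \<open>simp_all add: HomZ_def hom_def\<close>)
qed

end

section \<open>The object of additive maps: membership, evaluation, extensionality\<close>

context topos
begin

text \<open>The value f(n), for generalised elements f of \<open>[N, P]\<^sub>Z\<close> and n of N
  at a common stage.\<close>

abbreviation (input) ap :: "('o, 'm, 'g) abgrp_scheme \<Rightarrow> ('o, 'm, 'h) abgrp_scheme \<Rightarrow> 'm \<Rightarrow> 'm \<Rightarrow> 'm"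
  where "ap N P f n \<equiv> Ev E (Car N) (Car P) \<cdot> pair E (additive_maps E N P \<cdot> f) n"

definition additive_family ::
    "('o, 'm, 'g) abgrp_scheme \<Rightarrow> ('o, 'm, 'h) abgrp_scheme \<Rightarrow> 'o \<Rightarrow> 'm \<Rightarrow> bool" where
  "additive_family N P Z g \<longleftrightarrow>
    (\<forall>U. \<forall>a\<in>hom E U Z. \<forall>n\<in>hom E U (Car N). \<forall>n'\<in>hom E U (Car N).
      g \<cdot> pair E a (gadd N n n') = gadd P (g \<cdot> pair E a n) (g \<cdot> pair E a n'))"

context
  fixes N :: "('o, 'm, 'g) abgrp_scheme" and P :: "('o, 'm, 'h) abgrp_scheme"
  assumes N: "abelian_group_object E N" and P: "abelian_group_object E P"
begin

lemmas [simp] = abgrp_typing [OF N] abgrp_typing [OF P]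

text \<open>\<open>[N, P]\<^sub>Z\<close> is an equaliser of two transposes. By extensionality,
  equality of these after t amounts to a single equation over Z \<times> (N \<times> N), additivity
  at the generic pair n, n'.\<close>

lemma additive_maps_sub_le:
  fixes t Z
  defines "n \<equiv> Fst E (Car N) (Car N) \<cdot> Snd E Z (Prd E (Car N) (Car N))"
    and "n' \<equiv> Snd E (Car N) (Car N) \<cdot> Snd E Z (Prd E (Car N) (Car N))"
    and "f \<equiv> t \<cdot> Fst E Z (Prd E (Car N) (Car N))"
  assumes t: "t \<in> hom E Z (Exp E (Car N) (Car P))"
  shows "additive_maps E N P \<in> Sub E (Exp E (Car N) (Car P))"
    and "sub_le E t (additive_maps E N P) \<longleftrightarrow>
      Ev E (Car N) (Car P) \<cdot> pair E f (gadd N n n') =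
      gadd P (Ev E (Car N) (Car P) \<cdot> pair E f n) (Ev E (Car N) (Car P) \<cdot> pair E f n')"
proof -
  let ?X = "Car N" and ?Y = "Car P"
  let ?F = "Exp E ?X ?Y" and ?XX = "Prd E ?X ?X"
  let ?f = "Fst E ?F ?XX" and ?n = "Fst E ?X ?X \<cdot> Snd E ?F ?XX" and ?n' = "Snd E ?X ?X \<cdot> Snd E ?F ?XX"
  let ?L = "transpose E ?F ?XX ?Y (Ev E ?X ?Y \<cdot> pair E ?f (gadd N ?n ?n'))"
  let ?R = "transpose E ?F ?XX ?Y (gadd P (Ev E ?X ?Y \<cdot> pair E ?f ?n) (Ev E ?X ?Y \<cdot> pair E ?f ?n'))"
  have eql: "additive_maps E N P = Eql E ?L ?R"
    unfolding additive_maps_def Let_def ..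
  have L: "?L \<in> hom E ?F (Exp E ?XX ?Y)" and R: "?R \<in> hom E ?F (Exp E ?XX ?Y)"
    by (simp_all add: hom_def)
  show "additive_maps E N P \<in> Sub E (Exp E (Car N) (Car P))"
    unfolding eql by (rule Eql_Sub [OF L R])
  have Z: "Z \<in> Obj E" using hom_objs [OF t] by simp
  have "sub_le E t (additive_maps E N P) \<longleftrightarrow> ?L \<cdot> t = ?R \<cdot> t"
    unfolding eql by (rule Eql_sub_le [OF L R t])
  also have "\<dots> \<longleftrightarrow> Ev E ?XX ?Y \<cdot> pair E ((?L \<cdot> t) \<cdot> Fst E Z ?XX) (Snd E Z ?XX) =
      Ev E ?XX ?Y \<cdot> pair E ((?R \<cdot> t) \<cdot> Fst E Z ?XX) (Snd E Z ?XX)"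
    using Exp_ext [OF Comp_hom [OF t L] Comp_hom [OF t R]] by auto
  also have "\<dots> \<longleftrightarrow> Ev E ?X ?Y \<cdot> pair E f (gadd N n n') =
      gadd P (Ev E ?X ?Y \<cdot> pair E f n) (Ev E ?X ?Y \<cdot> pair E f n')"
    unfolding n_def n'_def f_def using homD [OF t] Z by simp
  finally show "sub_le E t (additive_maps E N P) \<longleftrightarrow>
      Ev E ?X ?Y \<cdot> pair E f (gadd N n n') =
      gadd P (Ev E ?X ?Y \<cdot> pair E f n) (Ev E ?X ?Y \<cdot> pair E f n')" .
qed

lemma additive_maps_Sub: "additive_maps E N P \<in> Sub E (Exp E (Car N) (Car P))"
  \<comment> \<open>The claim does not mention t; the identity of [N, P] merely supplies an arrow of
    the required type.\<close>
  by (rule additive_maps_sub_le(1) [OF Id_hom]) simp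

lemma ap_gadd:
  assumes f: "f \<in> hom E U (Dom E (additive_maps E N P))"
    and n: "n \<in> hom E U (Car N)" and n': "n' \<in> hom E U (Car N)"
  shows "ap N P f (gadd N n n') = gadd P (ap N P f n) (ap N P f n')"
proof -
  note [simp] = Sub_Arr [OF additive_maps_Sub] homD [OF f] homD [OF n] homD [OF n']
  have h: "additive_maps E N P \<cdot> f \<in> hom E U (Exp E (Car N) (Car P))" by (simp add: hom_def)
  have U: "U \<in> Obj E" using hom_objs [OF f] by simp
  have "sub_le E (additive_maps E N P \<cdot> f) (additive_maps E N P)"
    unfolding sub_le_def by (rule bexI [of _ f]) (simp_all add: hom_def)
  \<comment> \<open>The generic equation over U \<times> (N \<times> N) is specialised along (1, (n,
    n')).\<close>
  from arg_cong [OF this [unfolded additive_maps_sub_le(2) [OF h]],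
      of "\<lambda>k. k \<cdot> pair E (Id E U) (pair E n n')"]
  show ?thesis using U by simp
qed

text \<open>Additivity at the generic pair is the equaliser condition, so the transpose factors
  through \<open>[N, P]\<^sub>Z\<close>; the factorisation is unique since the inclusion is mono,
  which justifies the definite description. The second part is the beta rule for
  \<open>[N, P]\<^sub>Z\<close>.\<close>

lemma additive_transpose_props:
  assumes g: "g \<in> hom E (Prd E Z (Car N)) (Car P)" and Z: "Z \<in> Obj E"
    and add: "additive_family N P Z g"
  shows "additive_transpose E Z N P g \<in> hom E Z (Dom E (additive_maps E N P))"
    and "\<And>U a n. a \<in> hom E U Z \<Longrightarrow> n \<in> hom E U (Car N) \<Longrightarrow>
      ap N P (additive_transpose E Z N P g \<cdot> a) n = g \<cdot> pair E a n"
proof -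
  let ?i = "additive_maps E N P" and ?t = "transpose E Z (Car N) (Car P) g"
  let ?XX = "Prd E (Car N) (Car N)"
  note [simp] = Sub_Arr [OF additive_maps_Sub] homD [OF g]
  have t: "?t \<in> hom E Z (Exp E (Car N) (Car P))" using Z by (simp add: hom_def)
  have h: "Fst E Z ?XX \<in> hom E (Prd E Z ?XX) Z"
    "Fst E (Car N) (Car N) \<cdot> Snd E Z ?XX \<in> hom E (Prd E Z ?XX) (Car N)"
    "Snd E (Car N) (Car N) \<cdot> Snd E Z ?XX \<in> hom E (Prd E Z ?XX) (Car N)"
    using Z by (simp_all add: hom_def)
  have "sub_le E ?t ?i"
    unfolding additive_maps_sub_le(2) [OF t] using add [unfolded additive_family_def, rule_format, OF h] Z by simp
  then obtain k where k: "k \<in> hom E Z (Dom E ?i)" "?i \<cdot> k = ?t"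
    using homD [OF t] unfolding sub_le_def by auto
  have tk: "additive_transpose E Z N P g = k"
    unfolding additive_transpose_def factor_def
  proof (rule the_equality)
    show "k \<in> hom E (Dom E ?t) (Dom E ?i) \<and> ?i \<cdot> k = ?t" using k homD [OF t] by simp
    show "k' = k" if "k' \<in> hom E (Dom E ?t) (Dom E ?i) \<and> ?i \<cdot> k' = ?t" for k'
      by (rule mono_cancel [OF additive_maps_Sub _ k(1)]) (use that k(2) homD [OF t] in auto)
  qed
  show "additive_transpose E Z N P g \<in> hom E Z (Dom E ?i)" using tk k by simp
  fix U a n
  assume a: "a \<in> hom E U Z" and n: "n \<in> hom E U (Car N)"
  have "?i \<cdot> k \<cdot> a = (?i \<cdot> k) \<cdot> a" using homD [OF a] homD [OF k(1)] by simp
  also have "\<dots> = ?t \<cdot> a" unfolding k(2) ..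
  finally show "ap N P (additive_transpose E Z N P g \<cdot> a) n = g \<cdot> pair E a n"
    unfolding tk using homD [OF a] homD [OF n] Z by simp
qed

text \<open>The inclusion cancels, and extensionality of [N, P] uses only the values at the two
  projections of Z \<times> N.\<close>

lemma ap_ext:
  assumes f: "f \<in> hom E Z (Dom E (additive_maps E N P))"
    and g: "g \<in> hom E Z (Dom E (additive_maps E N P))"
    and eq: "\<And>U a n. a \<in> hom E U Z \<Longrightarrow> n \<in> hom E U (Car N) \<Longrightarrow>
      ap N P (f \<cdot> a) n = ap N P (g \<cdot> a) n"
  shows "f = g"
proof (rule mono_cancel [OF additive_maps_Sub f g])
  note [simp] = Sub_Arr [OF additive_maps_Sub] homD [OF f] homD [OF g]
  have Z: "Z \<in> Obj E" using hom_objs [OF f] by simp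
  have h: "additive_maps E N P \<cdot> f \<in> hom E Z (Exp E (Car N) (Car P))"
    "additive_maps E N P \<cdot> g \<in> hom E Z (Exp E (Car N) (Car P))"
    by (simp_all add: hom_def)
  show "additive_maps E N P \<cdot> f = additive_maps E N P \<cdot> g"
    by (rule Exp_ext [OF h])
      (use eq [of "Fst E Z (Car N)" "Prd E Z (Car N)" "Snd E Z (Car N)"] Z
        in \<open>simp_all add: hom_def\<close>)
qed

end

end

section \<open>The module structure on the object of additive maps\<close>

context topos
begin

lemma left_module_additive:
  assumes "left_module E A N" "a \<in> hom E U (Car A)" "n \<in> hom E U (Car N)" "n' \<in> hom E U (Car N)"
  shows "Act N \<cdot> pair E a (gadd N n n') = gadd N (Act N \<cdot> pair E a n) (Act N \<cdot> pair E a n')"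
proof -
  let ?R = "Car A" and ?X = "Car N"
  have N: "abelian_group_object E N" and act: "Act N \<in> hom E (Prd E ?R ?X) ?X"
    and eq: "Act N \<cdot> pair E (proj1 E ?R ?X ?X) (gadd N (proj2 E ?R ?X ?X) (proj3 E ?R ?X ?X)) =
      gadd N (Act N \<cdot> pair E (proj1 E ?R ?X ?X) (proj2 E ?R ?X ?X))
        (Act N \<cdot> pair E (proj1 E ?R ?X ?X) (proj3 E ?R ?X ?X))"
    using assms(1) unfolding left_module_def Let_def by blast+
  have "?R \<in> Obj E" using hom_objs [OF assms(2)] by simp
  with arg_cong [OF eq, of "\<lambda>k. k \<cdot> pair E (pair E a n) n'"] show ?thesis
    using homD [OF assms(2)] homD [OF assms(3)] homD [OF assms(4)] homD [OF act] abgrp_typing [OF N]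
    by (simp add: proj1_def proj2_def proj3_def)
qed

lemma left_module_typing:
  assumes "left_module E A N"
  shows "abelian_group_object E N" "Act N \<in> hom E (Prd E (Car A) (Car N)) (Car N)"
  using assms unfolding left_module_def Let_def by blast+

lemma hom_module_Car [simp]: "Car (hom_module E A N P) = Dom E (additive_maps E N P)"
  by (simp add: hom_module_def Let_def)

context
  fixes A :: "('o, 'm) ringob" and N :: "('o, 'm) modob" and P :: "('o, 'm) abgrp"
  assumes R: "Car A \<in> Obj E" and lN: "left_module E A N" and P: "abelian_group_object E P"
begin

text \<open>The pointwise sum is additive by the interchange law, hence it has a transpose. The
  second part computes that transpose on elements and stands in for the definition from here
  on.\<close>

lemma hom_module_Add:
  shows "Add (hom_module E A N P) \<in> hom E (Prd E (Dom E (additive_maps E N P))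
      (Dom E (additive_maps E N P))) (Dom E (additive_maps E N P))"
    and "\<And>U f g n. f \<in> hom E U (Dom E (additive_maps E N P)) \<Longrightarrow>
      g \<in> hom E U (Dom E (additive_maps E N P)) \<Longrightarrow> n \<in> hom E U (Car N) \<Longrightarrow>
      ap N P (Add (hom_module E A N P) \<cdot> pair E f g) n = gadd P (ap N P f n) (ap N P g n)"
proof -
  let ?i = "additive_maps E N P" let ?H = "Dom E ?i" and ?X = "Car N"
  note N = left_module_typing(1) [OF lN]
  note [simp] = abgrp_typing [OF N] abgrp_typing [OF P] Sub_Arr [OF additive_maps_Sub [OF N P]]
    proj1_def proj2_def proj3_def
  let ?g = "gadd P (ap N P (proj1 E ?H ?H ?X) (proj3 E ?H ?H ?X))
    (ap N P (proj2 E ?H ?H ?X) (proj3 E ?H ?H ?X))"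
  have g: "?g \<in> hom E (Prd E (Prd E ?H ?H) ?X) (Car P)" by (simp add: hom_def)
  have app: "ap N P (Fst E ?H ?H \<cdot> a) n \<in> hom E U (Car P)" "ap N P (Snd E ?H ?H \<cdot> a) n \<in> hom E U (Car P)"
    "Fst E ?H ?H \<cdot> a \<in> hom E U ?H" "Snd E ?H ?H \<cdot> a \<in> hom E U ?H"
    if "a \<in> hom E U (Prd E ?H ?H)" "n \<in> hom E U ?X" for a n U
    using homD [OF that(1)] homD [OF that(2)] by (simp_all add: hom_def)
  have gap: "?g \<cdot> pair E a n = gadd P (ap N P (Fst E ?H ?H \<cdot> a) n) (ap N P (Snd E ?H ?H \<cdot> a) n)"
    if "a \<in> hom E U (Prd E ?H ?H)" "n \<in> hom E U ?X" for a n U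
    using homD [OF that(1)] homD [OF that(2)] by simp
  have add: "?g \<cdot> pair E a (gadd N n n') = gadd P (?g \<cdot> pair E a n) (?g \<cdot> pair E a n')"
    if a: "a \<in> hom E U (Prd E ?H ?H)" and n: "n \<in> hom E U ?X" "n' \<in> hom E U ?X" for U a n n'
    unfolding gap [OF a gadd_hom [OF N n]] gap [OF a n(1)] gap [OF a n(2)]
      ap_gadd [OF N P app(3) [OF a n(1)] n] ap_gadd [OF N P app(4) [OF a n(1)] n]
    by (rule gadd_interchange [OF P app(1) [OF a n(1)] app(1) [OF a n(2)]
          app(2) [OF a n(1)] app(2) [OF a n(2)]])
  have H: "Prd E ?H ?H \<in> Obj E" by simp
  have eq: "Add (hom_module E A N P) = additive_transpose E (Prd E ?H ?H) N P ?g"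
    by (simp add: hom_module_def Let_def)
  have fam: "additive_family N P (Prd E ?H ?H) ?g"
    unfolding additive_family_def by (intro allI ballI) (rule add)
  note props = additive_transpose_props [OF N P g H fam]
  show "Add (hom_module E A N P) \<in> hom E (Prd E ?H ?H) ?H"
    unfolding eq by (rule props(1))
  show "ap N P (Add (hom_module E A N P) \<cdot> pair E f g) n = gadd P (ap N P f n) (ap N P g n)"
    if f: "f \<in> hom E U ?H" and g: "g \<in> hom E U ?H" and n: "n \<in> hom E U ?X" for U f g n
  proof -
    have fg: "pair E f g \<in> hom E U (Prd E ?H ?H)"
      using homD [OF f] homD [OF g] by (simp add: hom_def)
    show ?thesis
      unfolding eq props(2) [OF fg n] gap [OF fg n] using homD [OF f] homD [OF g] by simp
  qed
qed

text \<open>f(a(n + n')) splits by additivity of the action and then by additivity of f, so f a is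
  again an additive map.\<close>

lemma hom_module_Act:
  shows "Act (hom_module E A N P) \<in> hom E (Prd E (Dom E (additive_maps E N P)) (Car A))
      (Dom E (additive_maps E N P))"
    and "\<And>U f a n. f \<in> hom E U (Dom E (additive_maps E N P)) \<Longrightarrow>
      a \<in> hom E U (Car A) \<Longrightarrow> n \<in> hom E U (Car N) \<Longrightarrow>
      ap N P (Act (hom_module E A N P) \<cdot> pair E f a) n = ap N P f (Act N \<cdot> pair E a n)"
proof -
  let ?i = "additive_maps E N P" let ?H = "Dom E ?i" and ?X = "Car N" and ?R = "Car A"
  note N = left_module_typing(1) [OF lN]
  note [simp] = abgrp_typing [OF N] abgrp_typing [OF P] Sub_Arr [OF additive_maps_Sub [OF N P]]
    proj1_def proj2_def proj3_def homD [OF left_module_typing(2) [OF lN]] R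
  let ?g = "ap N P (proj1 E ?H ?R ?X) (Act N \<cdot> pair E (proj2 E ?H ?R ?X) (proj3 E ?H ?R ?X))"
  have g: "?g \<in> hom E (Prd E (Prd E ?H ?R) ?X) (Car P)" by (simp add: hom_def)
  have gap: "?g \<cdot> pair E z n = ap N P (Fst E ?H ?R \<cdot> z) (Act N \<cdot> pair E (Snd E ?H ?R \<cdot> z) n)"
    if "z \<in> hom E U (Prd E ?H ?R)" "n \<in> hom E U ?X" for z n U
    using homD [OF that(1)] homD [OF that(2)] by simp
  have add: "?g \<cdot> pair E z (gadd N n n') = gadd P (?g \<cdot> pair E z n) (?g \<cdot> pair E z n')"
    if z: "z \<in> hom E U (Prd E ?H ?R)" and n: "n \<in> hom E U ?X" "n' \<in> hom E U ?X" for U z n n'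
  proof -
    have h: "Fst E ?H ?R \<cdot> z \<in> hom E U ?H" "Snd E ?H ?R \<cdot> z \<in> hom E U ?R"
      "Act N \<cdot> pair E (Snd E ?H ?R \<cdot> z) n \<in> hom E U ?X"
      "Act N \<cdot> pair E (Snd E ?H ?R \<cdot> z) n' \<in> hom E U ?X"
      using homD [OF z] homD [OF n(1)] homD [OF n(2)] by (simp_all add: hom_def)
    show ?thesis
      unfolding gap [OF z gadd_hom [OF N n]] gap [OF z n(1)] gap [OF z n(2)]
        left_module_additive [OF lN h(2) n] by (rule ap_gadd [OF N P h(1,3,4)])
  qed
  have H: "Prd E ?H ?R \<in> Obj E" by simp
  have eq: "Act (hom_module E A N P) = additive_transpose E (Prd E ?H ?R) N P ?g"
    by (simp add: hom_module_def Let_def)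
  have fam: "additive_family N P (Prd E ?H ?R) ?g"
    unfolding additive_family_def by (intro allI ballI) (rule add)
  note props = additive_transpose_props [OF N P g H fam]
  show "Act (hom_module E A N P) \<in> hom E (Prd E ?H ?R) ?H"
    unfolding eq by (rule props(1))
  show "ap N P (Act (hom_module E A N P) \<cdot> pair E f a) n = ap N P f (Act N \<cdot> pair E a n)"
    if f: "f \<in> hom E U ?H" and a: "a \<in> hom E U ?R" and n: "n \<in> hom E U ?X" for U f a n
  proof -
    have fa: "pair E f a \<in> hom E U (Prd E ?H ?R)"
      using homD [OF f] homD [OF a] by (simp add: hom_def)
    show ?thesis
      unfolding eq props(2) [OF fa n] gap [OF fa n] using homD [OF f] homD [OF a] by simp
  qed
qed

lemma hom_module_map_props:
  assumes Q: "abelian_group_object E Q" and q: "q \<in> HomZ E P Q"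
  shows "hom_module_map E N P Q q \<in> hom E (Dom E (additive_maps E N P)) (Dom E (additive_maps E N Q))"
    and "\<And>U f n. f \<in> hom E U (Dom E (additive_maps E N P)) \<Longrightarrow> n \<in> hom E U (Car N) \<Longrightarrow>
      ap N Q (hom_module_map E N P Q q \<cdot> f) n = q \<cdot> ap N P f n"
proof -
  let ?i = "additive_maps E N P" let ?H = "Dom E ?i" and ?X = "Car N"
  note N = left_module_typing(1) [OF lN]
  have qh: "q \<in> hom E (Car P) (Car Q)" using q unfolding HomZ_def by simp
  note [simp] = abgrp_typing [OF N] abgrp_typing [OF P] abgrp_typing [OF Q] homD [OF qh]
    Sub_Arr [OF additive_maps_Sub [OF N P]]
  let ?g = "q \<cdot> uncurry E ?H ?X (Car P) ?i"
  have g: "?g \<in> hom E (Prd E ?H ?X) (Car Q)" by (simp add: hom_def uncurry_def)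
  have gap: "?g \<cdot> pair E f n = q \<cdot> ap N P f n"
    if "f \<in> hom E U ?H" "n \<in> hom E U ?X" for f n U
    using homD [OF that(1)] homD [OF that(2)] by (simp add: uncurry_def)
  have add: "?g \<cdot> pair E f (gadd N n n') = gadd Q (?g \<cdot> pair E f n) (?g \<cdot> pair E f n')"
    if f: "f \<in> hom E U ?H" and n: "n \<in> hom E U ?X" "n' \<in> hom E U ?X" for U f n n'
  proof -
    have h: "ap N P f n \<in> hom E U (Car P)" "ap N P f n' \<in> hom E U (Car P)"
      using homD [OF f] homD [OF n(1)] homD [OF n(2)] by (simp_all add: hom_def)
    show ?thesis
      unfolding gap [OF f gadd_hom [OF N n]] gap [OF f n(1)] gap [OF f n(2)] ap_gadd [OF N P f n]
      by (rule HomZ_gadd [OF P Q q h])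
  qed
  have H: "?H \<in> Obj E" by simp
  have eq: "hom_module_map E N P Q q = additive_transpose E ?H N Q ?g"
    by (simp add: hom_module_map_def Let_def)
  have fam: "additive_family N Q ?H ?g"
    unfolding additive_family_def by (intro allI ballI) (rule add)
  note props = additive_transpose_props [OF N Q g H fam]
  show "hom_module_map E N P Q q \<in> hom E ?H (Dom E (additive_maps E N Q))"
    unfolding eq by (rule props(1))
  show "ap N Q (hom_module_map E N P Q q \<cdot> f) n = q \<cdot> ap N P f n"
    if "f \<in> hom E U ?H" "n \<in> hom E U ?X" for U f n
    unfolding eq props(2) [OF that] gap [OF that] ..
qed

end

end

section \<open>Balanced biadditive maps and the tensor arrow\<close>

context topos
begin

text \<open>Evaluation turns a linear map M \<rightarrow> \<open>[N, P]\<^sub>Z\<close> into its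
  classical form, a biadditive and A-balanced map M \<times> N \<rightarrow> P; additivity in N is
  built into the codomain. It serves twice: to read off the laws of the tensor from the unit, and to
  show that the lifted unit is linear.\<close>

lemma HomA_hom_module_iff:
  assumes R: "Car A \<in> Obj E" and lN: "left_module E A N" and P: "abelian_group_object E P"
    and M: "abelian_group_object E M" and act: "Act M \<in> hom E (Prd E (Car M) (Car A)) (Car M)"
  shows "\<beta> \<in> HomA E A M (hom_module E A N P) \<longleftrightarrow>
    \<beta> \<in> hom E (Car M) (Dom E (additive_maps E N P)) \<and>
    (\<forall>U. \<forall>m\<in>hom E U (Car M). \<forall>m'\<in>hom E U (Car M). \<forall>n\<in>hom E U (Car N).
      ap N P (\<beta> \<cdot> gadd M m m') n = gadd P (ap N P (\<beta> \<cdot> m) n) (ap N P (\<beta> \<cdot> m') n)) \<and>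
    (\<forall>U. \<forall>m\<in>hom E U (Car M). \<forall>a\<in>hom E U (Car A). \<forall>n\<in>hom E U (Car N).
      ap N P (\<beta> \<cdot> Act M \<cdot> pair E m a) n = ap N P (\<beta> \<cdot> m) (Act N \<cdot> pair E a n))"
    (is "?l \<longleftrightarrow> ?h \<and> ?a \<and> ?b")
proof -
  let ?H = "Dom E (additive_maps E N P)" and ?K = "hom_module E A N P" and ?M = "Car M"
  note N = left_module_typing(1) [OF lN]
  note hA = hom_module_Add [OF R lN P] and hB = hom_module_Act [OF R lN P]
  note [simp] = abgrp_typing [OF N] abgrp_typing [OF P] abgrp_typing [OF M] homD [OF act] R
    homD [OF hA(1)] homD [OF hB(1)] Sub_Arr [OF additive_maps_Sub [OF N P]]
  have l: "?l \<longleftrightarrow> ?h \<and> \<beta> \<cdot> Add M = Add ?K \<cdot> pair E (\<beta> \<cdot> Fst E ?M ?M) (\<beta> \<cdot> Snd E ?M ?M) \<and>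
      \<beta> \<cdot> Act M = Act ?K \<cdot> pair E (\<beta> \<cdot> Fst E ?M (Car A)) (Snd E ?M (Car A))"
    unfolding HomA_def HomZ_def by simp
  show ?thesis
  proof (cases ?h)
    case False then show ?thesis using l by blast
  next
    case h: True
    note [simp] = homD [OF h]
    have "\<beta> \<cdot> Add M = Add ?K \<cdot> pair E (\<beta> \<cdot> Fst E ?M ?M) (\<beta> \<cdot> Snd E ?M ?M) \<longleftrightarrow> ?a"
    proof
      assume eq: "\<beta> \<cdot> Add M = Add ?K \<cdot> pair E (\<beta> \<cdot> Fst E ?M ?M) (\<beta> \<cdot> Snd E ?M ?M)"
      show ?a
      proof (intro allI ballI)
        fix U m m' n
        assume m: "m \<in> hom E U ?M" "m' \<in> hom E U ?M" and n: "n \<in> hom E U (Car N)"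
        have "\<beta> \<cdot> gadd M m m' = Add ?K \<cdot> pair E (\<beta> \<cdot> m) (\<beta> \<cdot> m')"
          using arg_cong [OF eq, of "\<lambda>k. k \<cdot> pair E m m'"] homD [OF m(1)] homD [OF m(2)] by simp
        then show "ap N P (\<beta> \<cdot> gadd M m m') n = gadd P (ap N P (\<beta> \<cdot> m) n) (ap N P (\<beta> \<cdot> m') n)"
          using hA(2) [OF Comp_hom [OF m(1) h] Comp_hom [OF m(2) h] n] by simp
      qed
    next
      assume a: ?a
      show "\<beta> \<cdot> Add M = Add ?K \<cdot> pair E (\<beta> \<cdot> Fst E ?M ?M) (\<beta> \<cdot> Snd E ?M ?M)"
      proof (rule ap_ext [OF N P, of _ "Prd E ?M ?M"])
        fix U z n
        assume z: "z \<in> hom E U (Prd E ?M ?M)" and n: "n \<in> hom E U (Car N)"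
        note [simp] = homD [OF z] homD [OF n]
        have m: "Fst E ?M ?M \<cdot> z \<in> hom E U ?M" "Snd E ?M ?M \<cdot> z \<in> hom E U ?M"
          by (simp_all add: hom_def)
        \<comment> \<open>An element of M \<times> M is the pair of its components, so the
          assumption on pairs of elements yields the equation of arrows.\<close>
        have zz: "pair E (Fst E ?M ?M \<cdot> z) (Snd E ?M ?M \<cdot> z) = z" by (rule pair_ext) simp_all
        show "ap N P ((\<beta> \<cdot> Add M) \<cdot> z) n =
          ap N P ((Add ?K \<cdot> pair E (\<beta> \<cdot> Fst E ?M ?M) (\<beta> \<cdot> Snd E ?M ?M)) \<cdot> z) n"
          using a [rule_format, OF m n] zz hA(2) [OF Comp_hom [OF m(1) h] Comp_hom [OF m(2) h] n]
          by simp
      qed (simp_all add: hom_def)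
    qed
    moreover have "\<beta> \<cdot> Act M = Act ?K \<cdot> pair E (\<beta> \<cdot> Fst E ?M (Car A)) (Snd E ?M (Car A)) \<longleftrightarrow> ?b"
    proof
      assume eq: "\<beta> \<cdot> Act M = Act ?K \<cdot> pair E (\<beta> \<cdot> Fst E ?M (Car A)) (Snd E ?M (Car A))"
      show ?b
      proof (intro allI ballI)
        fix U m a n
        assume m: "m \<in> hom E U ?M" and a: "a \<in> hom E U (Car A)" and n: "n \<in> hom E U (Car N)"
        have "\<beta> \<cdot> Act M \<cdot> pair E m a = Act ?K \<cdot> pair E (\<beta> \<cdot> m) a"
          using arg_cong [OF eq, of "\<lambda>k. k \<cdot> pair E m a"] homD [OF m] homD [OF a] by simp
        then show "ap N P (\<beta> \<cdot> Act M \<cdot> pair E m a) n = ap N P (\<beta> \<cdot> m) (Act N \<cdot> pair E a n)"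
          using hB(2) [OF Comp_hom [OF m h] a n] by simp
      qed
    next
      assume b: ?b
      show "\<beta> \<cdot> Act M = Act ?K \<cdot> pair E (\<beta> \<cdot> Fst E ?M (Car A)) (Snd E ?M (Car A))"
      proof (rule ap_ext [OF N P, of _ "Prd E ?M (Car A)"])
        fix U z n
        assume z: "z \<in> hom E U (Prd E ?M (Car A))" and n: "n \<in> hom E U (Car N)"
        note [simp] = homD [OF z] homD [OF n]
        have m: "Fst E ?M (Car A) \<cdot> z \<in> hom E U ?M" "Snd E ?M (Car A) \<cdot> z \<in> hom E U (Car A)"
          by (simp_all add: hom_def)
        have zz: "pair E (Fst E ?M (Car A) \<cdot> z) (Snd E ?M (Car A) \<cdot> z) = z"
          by (rule pair_ext) simp_all
        show "ap N P ((\<beta> \<cdot> Act M) \<cdot> z) n =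
          ap N P ((Act ?K \<cdot> pair E (\<beta> \<cdot> Fst E ?M (Car A)) (Snd E ?M (Car A))) \<cdot> z) n"
          using b [rule_format, OF m n] zz hB(2) [OF Comp_hom [OF m(1) h] m(2) n] by simp
      qed (simp_all add: hom_def)
    qed
    ultimately show ?thesis using l by blast
  qed
qed

context
  fixes A :: "('o, 'm) ringob" and M N :: "('o, 'm) modob"
    and T :: "('o, 'm) abgrp" and \<Phi> :: "('o, 'm) abgrp \<Rightarrow> 'm \<Rightarrow> 'm"
  assumes rA: "ring_object E A" and rM: "right_module E A M" and lN: "left_module E A N"
    and rep: "represents_tensor E A M N T \<Phi>"
begin

lemma tensor_group: "abelian_group_object E T"
  using rep unfolding represents_tensor_def by blast

lemma tensor_modules:
  shows "Car A \<in> Obj E" "abelian_group_object E M"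
    "Act M \<in> hom E (Prd E (Car M) (Car A)) (Car M)" "abelian_group_object E N"
  using rA rM lN
  unfolding ring_object_def right_module_def left_module_def Let_def abelian_group_object_def
  by blast+

lemma Id_HomZ: "Id E (Car T) \<in> HomZ E T T"
  using abgrp_typing [OF tensor_group] by (simp add: HomZ_def hom_def)

lemma tensor_unit: "\<Phi> T (Id E (Car T)) \<in> HomA E A M (hom_module E A N T)"
  using rep tensor_group Id_HomZ unfolding represents_tensor_def bij_betw_def by blast

lemmas tensor_unit_props =
  tensor_unit [unfolded HomA_hom_module_iff [OF tensor_modules(1) lN tensor_group tensor_modules(2,3)]]

text \<open>The beta rule for the tensor, through which the properties of the unit are carried over
  to m \<otimes> n.\<close>

lemma tensor_map_props:
  shows "tensor_map E M N T \<Phi> \<in> hom E (Prd E (Car M) (Car N)) (Car T)"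
    and "\<And>U m n. m \<in> hom E U (Car M) \<Longrightarrow> n \<in> hom E U (Car N) \<Longrightarrow>
      tensor_map E M N T \<Phi> \<cdot> pair E m n = ap N T (\<Phi> T (Id E (Car T)) \<cdot> m) n"
proof -
  let ?\<eta> = "\<Phi> T (Id E (Car T))"
  have \<eta>: "?\<eta> \<in> hom E (Car M) (Dom E (additive_maps E N T))" using tensor_unit_props by blast
  note N = tensor_modules(4) and M = tensor_modules(2)
  note [simp] = abgrp_typing [OF N] abgrp_typing [OF M] abgrp_typing [OF tensor_group] homD [OF \<eta>]
    Sub_Arr [OF additive_maps_Sub [OF N tensor_group]]
  show "tensor_map E M N T \<Phi> \<in> hom E (Prd E (Car M) (Car N)) (Car T)"
    by (simp add: tensor_map_def uncurry_def hom_def)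
  show "tensor_map E M N T \<Phi> \<cdot> pair E m n = ap N T (?\<eta> \<cdot> m) n"
    if "m \<in> hom E U (Car M)" "n \<in> hom E U (Car N)" for U m n
    using homD [OF that(1)] homD [OF that(2)] by (simp add: tensor_map_def uncurry_def)
qed

lemma tensor_map_additive:
  assumes m: "m \<in> hom E U (Car M)" "m' \<in> hom E U (Car M)" and n: "n \<in> hom E U (Car N)"
  shows "tensor_map E M N T \<Phi> \<cdot> pair E (gadd M m m') n =
    gadd T (tensor_map E M N T \<Phi> \<cdot> pair E m n) (tensor_map E M N T \<Phi> \<cdot> pair E m' n)"
  unfolding tensor_map_props(2) [OF m(1) n] tensor_map_props(2) [OF m(2) n]
    tensor_map_props(2) [OF gadd_hom [OF tensor_modules(2) m] n]
  using tensor_unit_props m n by blast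

text \<open>The values of the unit lie in \<open>[N, T]\<^sub>Z\<close>; additivity on the left, by
  contrast, is additivity of the unit itself.\<close>

lemma tensor_map_additive_right:
  assumes m: "m \<in> hom E U (Car M)" and n: "n \<in> hom E U (Car N)" "n' \<in> hom E U (Car N)"
  shows "tensor_map E M N T \<Phi> \<cdot> pair E m (gadd N n n') =
    gadd T (tensor_map E M N T \<Phi> \<cdot> pair E m n) (tensor_map E M N T \<Phi> \<cdot> pair E m n')"
proof -
  have "\<Phi> T (Id E (Car T)) \<in> hom E (Car M) (Dom E (additive_maps E N T))"
    using tensor_unit_props by blast
  then show ?thesis
    unfolding tensor_map_props(2) [OF m n(1)] tensor_map_props(2) [OF m n(2)]
      tensor_map_props(2) [OF m gadd_hom [OF tensor_modules(4) n]]
    using ap_gadd [OF tensor_modules(4) tensor_group Comp_hom [OF m] n] by blast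
qed

text \<open>Linearity of the unit over A, where the action on \<open>[N, T]\<^sub>Z\<close> is (f
  a)(n) = f(a n).\<close>

lemma tensor_map_balanced:
  assumes m: "m \<in> hom E U (Car M)" and a: "a \<in> hom E U (Car A)" and n: "n \<in> hom E U (Car N)"
  shows "tensor_map E M N T \<Phi> \<cdot> pair E (Act M \<cdot> pair E m a) n =
    tensor_map E M N T \<Phi> \<cdot> pair E m (Act N \<cdot> pair E a n)"
proof -
  note [simp] = homD [OF m] homD [OF a] homD [OF n] homD [OF tensor_modules(3)]
    homD [OF left_module_typing(2) [OF lN]]
  have h: "Act M \<cdot> pair E m a \<in> hom E U (Car M)" "Act N \<cdot> pair E a n \<in> hom E U (Car N)"
    by (simp_all add: hom_def)
  show ?thesis
    unfolding tensor_map_props(2) [OF h(1) n] tensor_map_props(2) [OF m h(2)]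
    using tensor_unit_props m a n by blast
qed

text \<open>0 \<otimes> n is idempotent for addition, hence zero, so (-m) \<otimes> n is inverse to
  m \<otimes> n. Negatives of pure tensors are thus pure tensors, which keeps the sums closed under
  negation.\<close>

lemma tensor_map_neg:
  assumes m: "m \<in> hom E U (Car M)" and n: "n \<in> hom E U (Car N)"
  shows "Neg T \<cdot> tensor_map E M N T \<Phi> \<cdot> pair E m n =
    tensor_map E M N T \<Phi> \<cdot> pair E (Neg M \<cdot> m) n"
proof -
  let ?t = "tensor_map E M N T \<Phi>"
  note M = tensor_modules(2)
  note [simp] = homD [OF m] homD [OF n] homD [OF tensor_map_props(1)] abgrp_typing [OF M]
  have U: "U \<in> Obj E" using hom_objs [OF m] by simp
  have z: "Zero M \<cdot> bang E U \<in> hom E U (Car M)" and nm: "Neg M \<cdot> m \<in> hom E U (Car M)"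
    using U by (simp_all add: hom_def)
  have t: "?t \<cdot> pair E m' n \<in> hom E U (Car T)" if "m' \<in> hom E U (Car M)" for m'
    using homD [OF that] by (simp add: hom_def)
  have "?t \<cdot> pair E (Zero M \<cdot> bang E U) n = Zero T \<cdot> bang E U"
    by (rule idem_is_zero [OF tensor_group t [OF z]])
      (simp only: tensor_map_additive [OF z z n, symmetric] gadd_zero [OF M z])
  then show ?thesis
    by (intro neg_unique [OF tensor_group t [OF m] t [OF nm]])
      (simp only: tensor_map_additive [OF nm m n, symmetric] gadd_neg [OF M m])
qed

text \<open>The universal property forces generation. The subgroup is arbitrary here, so the
  statement is independent of the formula and of how its extent is constructed.\<close>

lemma tensor_subgroup_full:
  fixes G :: "('o, 'm) abgrp"
  assumes G: "abelian_group_object E G" and s: "s \<in> Sub E (Car T)" and CG: "Car G = Dom E s"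
    and sh: "s \<in> HomZ E G T" and fac: "sub_le E (tensor_map E M N T \<Phi>) s"
  shows "sub_le E (Id E (Car T)) s"
proof -
  let ?t = "tensor_map E M N T \<Phi>" and ?\<eta> = "\<Phi> T (Id E (Car T))"
  let ?HG = "Dom E (additive_maps E N G)" and ?HT = "Dom E (additive_maps E N T)"
  note N = tensor_modules(4) and M = tensor_modules(2) and T = tensor_group
  note t = tensor_map_props(1)
  \<comment> \<open>u is the tensor with codomain restricted to G. Its biadditivity and balancedness
    are checked after composing with the monic homomorphism s.\<close>
  obtain u where u: "u \<in> hom E (Prd E (Car M) (Car N)) (Car G)" and su: "s \<cdot> u = ?t"
    using fac homD [OF t] unfolding sub_le_def CG by auto
  note [simp] = abgrp_typing [OF N] abgrp_typing [OF M] abgrp_typing [OF G] abgrp_typing [OF T]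
    homD [OF t] homD [OF u] Sub_Arr [OF s] CG [symmetric] homD [OF tensor_modules(3)]
    homD [OF left_module_typing(2) [OF lN]] tensor_modules(1)
  have su': "s \<cdot> u \<cdot> z = ?t \<cdot> z" if "z \<in> Arr E" "Cod E z = Prd E (Car M) (Car N)" for z
    using that comp_assoc [of z u s] su by simp
  have eqI: "f = g" if "f \<in> hom E Z (Car G)" "g \<in> hom E Z (Car G)" "s \<cdot> f = s \<cdot> g" for f g Z
    by (rule mono_cancel [OF s, of f Z g]) (use that in simp_all)
  have fam: "additive_family N G (Car M) u"
    unfolding additive_family_def
  proof (intro allI ballI)
    fix U m n n'
    assume m: "m \<in> hom E U (Car M)" and n: "n \<in> hom E U (Car N)" "n' \<in> hom E U (Car N)"
    note [simp] = homD [OF m] homD [OF n(1)] homD [OF n(2)]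
    have h: "u \<cdot> pair E m n \<in> hom E U (Car G)" "u \<cdot> pair E m n' \<in> hom E U (Car G)"
      by (simp_all add: hom_def)
    show "u \<cdot> pair E m (gadd N n n') = gadd G (u \<cdot> pair E m n) (u \<cdot> pair E m n')"
      by (rule eqI [of _ U])
        (simp_all add: HomZ_gadd [OF G T sh h] su' tensor_map_additive_right [OF m n], simp_all add: hom_def)
  qed
  \<comment> \<open>\<beta> : M \<rightarrow> \<open>[N, G]\<^sub>Z\<close> is the lift of the
    unit.\<close>
  define \<beta> where "\<beta> = additive_transpose E (Car M) N G u"
  note \<beta> = additive_transpose_props [OF N G u _ fam, folded \<beta>_def]
  have \<beta>h: "\<beta> \<in> hom E (Car M) ?HG" by (rule \<beta>(1)) simp
  have ap\<beta>: "ap N G (\<beta> \<cdot> m) n = u \<cdot> pair E m n"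
    if "m \<in> hom E U (Car M)" "n \<in> hom E U (Car N)" for U m n
    by (rule \<beta>(2) [OF _ that]) simp
  have "\<beta> \<in> HomA E A M (hom_module E A N G)"
    unfolding HomA_hom_module_iff [OF tensor_modules(1) lN G tensor_modules(2,3)]
  proof (intro conjI allI ballI)
    fix U m m' n
    assume m: "m \<in> hom E U (Car M)" "m' \<in> hom E U (Car M)" and n: "n \<in> hom E U (Car N)"
    note [simp] = homD [OF m(1)] homD [OF m(2)] homD [OF n]
    have h: "u \<cdot> pair E m n \<in> hom E U (Car G)" "u \<cdot> pair E m' n \<in> hom E U (Car G)"
      by (simp_all add: hom_def)
    show "ap N G (\<beta> \<cdot> gadd M m m') n = gadd G (ap N G (\<beta> \<cdot> m) n) (ap N G (\<beta> \<cdot> m') n)"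
      unfolding ap\<beta> [OF m(1) n] ap\<beta> [OF m(2) n] ap\<beta> [OF gadd_hom [OF M m] n]
      by (rule eqI [of _ U])
        (simp_all add: HomZ_gadd [OF G T sh h] su' tensor_map_additive [OF m n], simp_all add: hom_def)
  next
    fix U m a n
    assume m: "m \<in> hom E U (Car M)" and a: "a \<in> hom E U (Car A)" and n: "n \<in> hom E U (Car N)"
    note [simp] = homD [OF m] homD [OF a] homD [OF n]
    have h: "Act M \<cdot> pair E m a \<in> hom E U (Car M)" "Act N \<cdot> pair E a n \<in> hom E U (Car N)"
      by (simp_all add: hom_def)
    show "ap N G (\<beta> \<cdot> Act M \<cdot> pair E m a) n = ap N G (\<beta> \<cdot> m) (Act N \<cdot> pair E a n)"
      unfolding ap\<beta> [OF h(1) n] ap\<beta> [OF m h(2)]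
      by (rule eqI [of _ U])
        (simp_all add: su' tensor_map_balanced [OF m a n], simp_all add: hom_def)
  qed (rule \<beta>h)
  moreover have "\<Phi> G ` HomZ E T G = HomA E A M (hom_module E A N G)"
    using rep G unfolding represents_tensor_def bij_betw_def by blast
  ultimately have "\<beta> \<in> \<Phi> G ` HomZ E T G" by (rule rev_subsetD [OF _ equalityD2])
  then obtain h where h: "h \<in> HomZ E T G" "\<Phi> G h = \<beta>" by blast
  have hh: "h \<in> hom E (Car T) (Car G)" using h(1) unfolding HomZ_def by simp
  note map = hom_module_map_props [OF tensor_modules(1) lN G T sh]
  have \<eta>h: "?\<eta> \<in> hom E (Car M) ?HT" using tensor_unit_props by blast
  \<comment> \<open>Composing with s undoes the lift: on elements both sides are m \<otimes> n,
    because s u is the tensor.\<close>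
  have "hom_module_map E N G T s \<cdot> \<beta> = ?\<eta>"
  proof (rule ap_ext [OF N T Comp_hom [OF \<beta>h map(1)] \<eta>h])
    fix U m n
    assume m: "m \<in> hom E U (Car M)" and n: "n \<in> hom E U (Car N)"
    note [simp] = homD [OF m] homD [OF n] homD [OF map(1)] homD [OF \<beta>h]
    have "ap N T ((hom_module_map E N G T s \<cdot> \<beta>) \<cdot> m) n = s \<cdot> ap N G (\<beta> \<cdot> m) n"
      using map(2) [OF Comp_hom [OF m \<beta>h] n] by simp
    also have "\<dots> = s \<cdot> u \<cdot> pair E m n" unfolding ap\<beta> [OF m n] ..
    also have "\<dots> = ap N T (?\<eta> \<cdot> m) n"
      using tensor_map_props(2) [OF m n] by (simp add: su')
    finally show "ap N T ((hom_module_map E N G T s \<cdot> \<beta>) \<cdot> m) n = ap N T (?\<eta> \<cdot> m) n" .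
  qed
  \<comment> \<open>Naturality along s : G \<rightarrow> T. It gives s h and the identity the same
    image under \<open>\<Phi> T\<close>, whose injectivity on endomorphisms of T then identifies
    them.\<close>
  moreover have "\<Phi> T (s \<cdot> h) = hom_module_map E N G T s \<cdot> \<Phi> G h"
    using rep G T sh h(1) unfolding represents_tensor_def by blast
  ultimately have eq: "\<Phi> T (s \<cdot> h) = ?\<eta>" using h(2) by simp
  have "s \<cdot> h \<in> HomZ E T T"
  proof (rule HomZ_I [OF T T])
    show "s \<cdot> h \<in> hom E (Car T) (Car T)" using homD [OF hh] by (simp add: hom_def)
    fix U f g
    assume fg: "f \<in> hom E U (Car T)" "g \<in> hom E U (Car T)"
    note [simp] = homD [OF hh] homD [OF fg(1)] homD [OF fg(2)]
    show "(s \<cdot> h) \<cdot> gadd T f g = gadd T ((s \<cdot> h) \<cdot> f) ((s \<cdot> h) \<cdot> g)"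
      using HomZ_gadd [OF T G h(1) fg]
        HomZ_gadd [OF G T sh Comp_hom [OF fg(1) hh] Comp_hom [OF fg(2) hh]] by simp
  qed
  moreover have "inj_on (\<Phi> T) (HomZ E T T)"
    using rep T unfolding represents_tensor_def bij_betw_def by blast
  ultimately have "s \<cdot> h = Id E (Car T)" using eq Id_HomZ by (auto dest: inj_onD)
  then show ?thesis unfolding sub_le_def using hh by auto
qed

end

end

section \<open>Formulas as least subobjects\<close>

locale geometric_topos = topos E + geometric_category E
  for E :: "('o, 'm, 'e) topos_data_scheme" (structure)
begin

lemma image_of_is_image: "f \<in> Arr E \<Longrightarrow> is_image E f (image_of E f)"
  unfolding image_of_def using image_exists by (rule someI_ex)

lemma union_of_is_union: "X \<in> Obj E \<Longrightarrow> S \<subseteq> Sub E X \<Longrightarrow> is_union E X S (union_of E X S)"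
  unfolding union_of_def using union_exists by (rule someI_ex)

text \<open>
  Exponentials make universal quantification along any arrow definable, so a subobject need only be
  known through its universal property with respect to generalised elements.
\<close>

definition least_sub :: "'o \<Rightarrow> 'm \<Rightarrow> ('o \<Rightarrow> 'm \<Rightarrow> bool) \<Rightarrow> bool" where
  "least_sub X s Q \<longleftrightarrow> s \<in> Sub E X \<and> (\<forall>U. \<forall>a\<in>hom E U X. Q U a \<longrightarrow> sub_le E a s) \<and>
    (\<forall>n\<in>Sub E X. (\<forall>U. \<forall>a\<in>hom E U X. Q U a \<longrightarrow> sub_le E a n) \<longrightarrow> sub_le E s n)"

lemma least_subI:
  assumes "s \<in> Sub E X" "\<And>U a. a \<in> hom E U X \<Longrightarrow> Q U a \<Longrightarrow> sub_le E a s"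
    and "\<And>n. n \<in> Sub E X \<Longrightarrow> (\<And>U a. a \<in> hom E U X \<Longrightarrow> Q U a \<Longrightarrow> sub_le E a n) \<Longrightarrow> sub_le E s n"
  shows "least_sub X s Q"
  unfolding least_sub_def using assms by blast

lemma least_subD:
  assumes "least_sub X s Q"
  shows "s \<in> Sub E X" "\<And>U a. a \<in> hom E U X \<Longrightarrow> Q U a \<Longrightarrow> sub_le E a s"
    and "\<And>n. n \<in> Sub E X \<Longrightarrow> (\<And>U a. a \<in> hom E U X \<Longrightarrow> Q U a \<Longrightarrow> sub_le E a n) \<Longrightarrow> sub_le E s n"
  using assms unfolding least_sub_def by blast+

text \<open>\<open>P U \<sigma>\<close> is literal truth at stage U, without passage to covers;
  hence the interpretation is only claimed to be least among the subobjects containing the elements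
  that satisfy P. The first clause makes P depend on W alone, since environments are arbitrary, and
  even untyped, outside W.\<close>

definition describes ::
    "'v set \<Rightarrow> ('v \<Rightarrow> 'o) \<Rightarrow> ('v, 'o, 'm) fm \<Rightarrow> ('o \<Rightarrow> ('v \<Rightarrow> 'm) \<Rightarrow> bool) \<Rightarrow> bool" where
  "describes W ty \<phi> P \<longleftrightarrow>
    (\<forall>U \<sigma> \<sigma>'. (\<forall>w\<in>W. \<sigma> w = \<sigma>' w) \<longrightarrow> P U \<sigma> \<longrightarrow> P U \<sigma>') \<and>
    (\<forall>X\<in>Obj E. \<forall>\<rho>. (\<forall>w\<in>W. \<rho> w \<in> hom E X (ty w)) \<longrightarrow>
      least_sub X (interp E \<phi> X \<rho>) (\<lambda>U a. P U (\<lambda>w. \<rho> w \<cdot> a)))"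

lemma describesI:
  assumes "\<And>U \<sigma> \<sigma>'. \<forall>w\<in>W. \<sigma> w = \<sigma>' w \<Longrightarrow> P U \<sigma> \<Longrightarrow> P U \<sigma>'"
    and "\<And>X \<rho>. X \<in> Obj E \<Longrightarrow> \<forall>w\<in>W. \<rho> w \<in> hom E X (ty w) \<Longrightarrow>
      least_sub X (interp E \<phi> X \<rho>) (\<lambda>U a. P U (\<lambda>w. \<rho> w \<cdot> a))"
  shows "describes W ty \<phi> P"
  unfolding describes_def using assms by blast

lemma describesD:
  assumes "describes W ty \<phi> P"
  shows "\<And>U \<sigma> \<sigma>'. P U \<sigma> \<Longrightarrow> \<forall>w\<in>W. \<sigma> w = \<sigma>' w \<Longrightarrow> P U \<sigma>'"
    and "\<And>X \<rho>. X \<in> Obj E \<Longrightarrow> \<forall>w\<in>W. \<rho> w \<in> hom E X (ty w) \<Longrightarrow>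
      least_sub X (interp E \<phi> X \<rho>) (\<lambda>U a. P U (\<lambda>w. \<rho> w \<cdot> a))"
  using assms unfolding describes_def by blast+

text \<open>An element lies in the equaliser exactly when it satisfies the equation. In particular
  the equaliser arrow, taken as an element at its own domain, satisfies it, and this gives
  leastness.\<close>

lemma describes_Equal:
  assumes cong: "\<And>U \<sigma> \<sigma>'. \<forall>w\<in>W. \<sigma> w = \<sigma>' w \<Longrightarrow>
      interp_trm E U \<sigma> s = interp_trm E U \<sigma>' s \<and> interp_trm E U \<sigma> t = interp_trm E U \<sigma>' t"
    and ty: "\<And>X \<rho>. X \<in> Obj E \<Longrightarrow> \<forall>w\<in>W. \<rho> w \<in> hom E X (ty w) \<Longrightarrow>
      interp_trm E X \<rho> s \<in> hom E X C \<and> interp_trm E X \<rho> t \<in> hom E X C"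
    and subst: "\<And>X \<rho> U a. X \<in> Obj E \<Longrightarrow> \<forall>w\<in>W. \<rho> w \<in> hom E X (ty w) \<Longrightarrow>
      a \<in> hom E U X \<Longrightarrow>
      interp_trm E X \<rho> s \<cdot> a = interp_trm E U (\<lambda>w. \<rho> w \<cdot> a) s \<and>
      interp_trm E X \<rho> t \<cdot> a = interp_trm E U (\<lambda>w. \<rho> w \<cdot> a) t"
  shows "describes W ty (Equal s t) (\<lambda>U \<sigma>. interp_trm E U \<sigma> s = interp_trm E U \<sigma> t)"
proof (rule describesI)
  show "interp_trm E U \<sigma>' s = interp_trm E U \<sigma>' t"
    if "\<forall>w\<in>W. \<sigma> w = \<sigma>' w" "interp_trm E U \<sigma> s = interp_trm E U \<sigma> t" for U \<sigma> \<sigma>'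
    using cong [OF that(1), of U] that(2) by metis
  fix X \<rho>
  assume X: "X \<in> Obj E" and \<rho>: "\<forall>w\<in>W. \<rho> w \<in> hom E X (ty w)"
  let ?s = "interp_trm E X \<rho> s" and ?t = "interp_trm E X \<rho> t"
  have st: "?s \<in> hom E X C" "?t \<in> hom E X C" using ty [OF X \<rho>] by blast+
  have iff: "sub_le E a (Eql E ?s ?t) \<longleftrightarrow>
      interp_trm E U (\<lambda>w. \<rho> w \<cdot> a) s = interp_trm E U (\<lambda>w. \<rho> w \<cdot> a) t" if "a \<in> hom E U X" for U a
    using Eql_sub_le [OF st that] subst [OF X \<rho> that] by simp
  show "least_sub X (interp E (Equal s t) X \<rho>)
    (\<lambda>U a. interp_trm E U (\<lambda>w. \<rho> w \<cdot> a) s = interp_trm E U (\<lambda>w. \<rho> w \<cdot> a) t)"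
  proof (rule least_subI)
    let ?e = "interp E (Equal s t) X \<rho>"
    show e: "?e \<in> Sub E X" using Eql_Sub [OF st] by simp
    show "sub_le E a ?e"
      if "a \<in> hom E U X" "interp_trm E U (\<lambda>w. \<rho> w \<cdot> a) s = interp_trm E U (\<lambda>w. \<rho> w \<cdot> a) t" for U a
      using iff [OF that(1)] that(2) by simp
    fix n
    assume n: "\<And>U a. a \<in> hom E U X \<Longrightarrow>
      interp_trm E U (\<lambda>w. \<rho> w \<cdot> a) s = interp_trm E U (\<lambda>w. \<rho> w \<cdot> a) t \<Longrightarrow> sub_le E a n"
    have eh: "?e \<in> hom E (Dom E ?e) X" using Sub_Arr [OF e] by (simp add: hom_def)
    then show "sub_le E ?e n"
      using n [OF eh] iff [OF eh] sub_le_refl [of ?e] Sub_Arr [OF e] by simp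
  qed
qed

text \<open>Image along the projection is left adjoint to preimage: a subobject contains the image
  once its preimage contains the extent of \<phi>, and by leastness only pairs (a, b) satisfying P
  need to be tested. Witnesses b can therefore be taken at the stage of a.\<close>

lemma describes_Exists:
  assumes \<phi>: "describes (insert v W) ty \<phi> P" and B: "ty v \<in> Obj E"
  shows "describes W ty (Exists v (ty v) \<phi>) (\<lambda>U \<sigma>. \<exists>b\<in>hom E U (ty v). P U (\<sigma>(v := b)))"
proof (rule describesI)
  let ?B = "ty v"
  fix U \<sigma> \<sigma>'
  assume eq: "\<forall>w\<in>W. \<sigma> w = \<sigma>' w" and "\<exists>b\<in>hom E U ?B. P U (\<sigma>(v := b))"
  then obtain b where b: "b \<in> hom E U ?B" "P U (\<sigma>(v := b))" by blast
  have "P U (\<sigma>'(v := b))" by (rule describesD(1) [OF \<phi>, OF b(2)]) (use eq in auto)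
  then show "\<exists>b\<in>hom E U ?B. P U (\<sigma>'(v := b))" using b(1) by blast
next
  let ?B = "ty v"
  fix X \<rho>
  assume X: "X \<in> Obj E" and \<rho>: "\<forall>w\<in>W. \<rho> w \<in> hom E X (ty w)"
  note [simp] = X B
  let ?\<rho> = "(\<lambda>w. \<rho> w \<cdot> Fst E X ?B)(v := Snd E X ?B)"
  let ?s = "interp E \<phi> (Prd E X ?B) ?\<rho>"
  have \<rho>': "\<forall>w\<in>insert v W. ?\<rho> w \<in> hom E (Prd E X ?B) (ty w)"
    using homD [OF \<rho> [rule_format]] by (auto simp: hom_def)
  note least = describesD(2) [OF \<phi> Prd_Obj [OF X B] \<rho>']
  have s: "?s \<in> Sub E (Prd E X ?B)" by (rule least_subD(1) [OF least])
  note [simp] = Sub_Arr [OF s]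
  let ?m = "interp E (Exists v ?B \<phi>) X \<rho>"
  have im: "is_image E (Fst E X ?B \<cdot> ?s) ?m" by (simp add: image_of_is_image)
  \<comment> \<open>The two environments agree on \<open>insert v W\<close> only: elsewhere \<rho>
    is untyped and the projection need not cancel. The congruence clause of \<open>describes\<close>
    bridges the difference.\<close>
  have env: "P U (\<lambda>w. ?\<rho> w \<cdot> pair E a b) \<longleftrightarrow> P U ((\<lambda>w. \<rho> w \<cdot> a)(v := b))"
    if "a \<in> hom E U X" "b \<in> hom E U ?B" for U a b
  proof -
    have eq: "\<forall>w\<in>insert v W. ?\<rho> w \<cdot> pair E a b = ((\<lambda>w. \<rho> w \<cdot> a)(v := b)) w"
    proof
      fix w
      assume w: "w \<in> insert v W"
      show "?\<rho> w \<cdot> pair E a b = ((\<lambda>w. \<rho> w \<cdot> a)(v := b)) w"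
        using w homD [OF \<open>a \<in> hom E U X\<close>] homD [OF \<open>b \<in> hom E U ?B\<close>] homD [OF \<rho> [rule_format, of w]]
        by (cases "w = v") auto
    qed
    show ?thesis
      by (rule iffI) (erule describesD(1) [OF \<phi>], use eq in auto)+
  qed
  show "least_sub X ?m (\<lambda>U a. \<exists>b\<in>hom E U ?B. P U ((\<lambda>w. \<rho> w \<cdot> a)(v := b)))"
  proof (rule least_subI)
    show m: "?m \<in> Sub E X" using im unfolding is_image_def by simp
    fix U a
    assume a: "a \<in> hom E U X" and "\<exists>b\<in>hom E U ?B. P U ((\<lambda>w. \<rho> w \<cdot> a)(v := b))"
    then obtain b where b: "b \<in> hom E U ?B" "P U ((\<lambda>w. \<rho> w \<cdot> a)(v := b))" by blast
    note [simp] = homD [OF a] homD [OF b(1)]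
    have ab: "pair E a b \<in> hom E U (Prd E X ?B)" by (simp add: hom_def)
    have "sub_le E (pair E a b) ?s"
      by (rule least_subD(2) [OF least ab]) (use env [OF a b(1)] b(2) in blast)+
    then obtain k where k: "k \<in> hom E U (Dom E ?s)" "?s \<cdot> k = pair E a b"
      unfolding sub_le_def by auto
    note [simp] = homD [OF k(1)]
    have "sub_le E (Fst E X ?B \<cdot> ?s) ?m" using im unfolding is_image_def sub_le_def by simp
    then have "sub_le E ((Fst E X ?B \<cdot> ?s) \<cdot> k) ?m"
      by (rule sub_le_comp) (use Sub_Arr [OF m] in simp_all)
    then show "sub_le E a ?m" using k(2) by simp
  next
    fix n
    assume n: "n \<in> Sub E X"
      and all: "\<And>U a. a \<in> hom E U X \<Longrightarrow> \<exists>b\<in>hom E U ?B. P U ((\<lambda>w. \<rho> w \<cdot> a)(v := b)) \<Longrightarrow> sub_le E a n"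
    have "Fst E X ?B \<in> hom E (Prd E X ?B) X" by (simp add: hom_def)
    then obtain n' where n': "n' \<in> Sub E (Prd E X ?B)"
      and le: "\<And>U a. a \<in> hom E U (Prd E X ?B) \<Longrightarrow> sub_le E a n' \<longleftrightarrow> sub_le E (Fst E X ?B \<cdot> a) n"
      using preimage_exists [OF n] by metis
    have "sub_le E ?s n'"
    proof (rule least_subD(3) [OF least n'])
      fix U c
      assume c: "c \<in> hom E U (Prd E X ?B)" and P: "P U (\<lambda>w. ?\<rho> w \<cdot> c)"
      note [simp] = homD [OF c]
      have h: "Fst E X ?B \<cdot> c \<in> hom E U X" "Snd E X ?B \<cdot> c \<in> hom E U ?B" by (simp_all add: hom_def)
      have "pair E (Fst E X ?B \<cdot> c) (Snd E X ?B \<cdot> c) = c" by (rule pair_ext) simp_all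
      then have "P U ((\<lambda>w. \<rho> w \<cdot> Fst E X ?B \<cdot> c)(v := Snd E X ?B \<cdot> c))"
        using P env [OF h] by simp
      then show "sub_le E c n'" unfolding le [OF c] using all [OF h(1)] h(2) by blast
    qed
    then have "sub_le E (Fst E X ?B \<cdot> ?s) n" using le [of ?s "Dom E ?s"] by (simp add: hom_def)
    then show "sub_le E ?m n" using im n unfolding is_image_def sub_le_def by simp
  qed
qed

text \<open>A subobject contains the union as soon as it contains each disjunct, so leastness can be
  tested with a single p for each element.\<close>

lemma describes_Disj:
  assumes \<Psi>: "\<And>p. describes W ty (\<Psi> p) (P p)"
  shows "describes W ty (Disj \<Psi>) (\<lambda>U \<sigma>. \<exists>p. P p U \<sigma>)"
proof (rule describesI)
  show "\<exists>p. P p U \<sigma>'" if "\<forall>w\<in>W. \<sigma> w = \<sigma>' w" "\<exists>p. P p U \<sigma>" for U \<sigma> \<sigma>'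
    using that describesD(1) [OF \<Psi>] by meson
  fix X \<rho>
  assume X: "X \<in> Obj E" and \<rho>: "\<forall>w\<in>W. \<rho> w \<in> hom E X (ty w)"
  note least = describesD(2) [OF \<Psi> X \<rho>]
  let ?S = "range (\<lambda>p. interp E (\<Psi> p) X \<rho>)" and ?m = "interp E (Disj \<Psi>) X \<rho>"
  have "?S \<subseteq> Sub E X" using least_subD(1) [OF least] by blast
  then have u: "is_union E X ?S ?m" using union_of_is_union [OF X] by simp
  then have m: "?m \<in> Sub E X" unfolding is_union_def by blast
  show "least_sub X ?m (\<lambda>U a. \<exists>p. P p U (\<lambda>w. \<rho> w \<cdot> a))"
  proof (rule least_subI [OF m])
    fix U a
    assume a: "a \<in> hom E U X" and "\<exists>p. P p U (\<lambda>w. \<rho> w \<cdot> a)"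
    then obtain p where "P p U (\<lambda>w. \<rho> w \<cdot> a)" by blast
    then have "sub_le E a (interp E (\<Psi> p) X \<rho>)" by (rule least_subD(2) [OF least a, rotated])
    moreover have "sub_le E (interp E (\<Psi> p) X \<rho>) ?m" using u unfolding is_union_def by blast
    ultimately show "sub_le E a ?m" by (rule sub_le_trans) (rule Sub_Arr(1) [OF m])
  next
    fix n
    assume n: "n \<in> Sub E X"
      and all: "\<And>U a. a \<in> hom E U X \<Longrightarrow> \<exists>p. P p U (\<lambda>w. \<rho> w \<cdot> a) \<Longrightarrow> sub_le E a n"
    have "sub_le E (interp E (\<Psi> p) X \<rho>) n" for p
      by (rule least_subD(3) [OF least n]) (use all in blast)+
    then show "sub_le E ?m n" using u n unfolding is_union_def by blast
  qed
qed

lemma describes_cong: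
  assumes "describes W ty \<phi> P" "\<And>U \<sigma>. P U \<sigma> \<longleftrightarrow> Q U \<sigma>"
  shows "describes W ty \<phi> Q"
proof -
  have "P = Q" using assms(2) by blast
  then show ?thesis using assms(1) by simp
qed

text \<open>A block of quantifiers amounts to one change of environment on the bound variables. Each
  quantifier moves its variable into the context, hence the induction with W arbitrary.\<close>

lemma describes_exists_list:
  assumes \<phi>: "describes (v ` {1..p} \<union> W) ty \<phi> P" and ty: "\<And>i. ty (v i) = B" and B: "B \<in> Obj E"
  shows "describes W ty (exists_list v B p \<phi>)
    (\<lambda>U \<sigma>. \<exists>\<sigma>'. (\<forall>w. w \<notin> v ` {1..p} \<longrightarrow> \<sigma>' w = \<sigma> w) \<and> (\<forall>i\<in>{1..p}. \<sigma>' (v i) \<in> hom E U B) \<and> P U \<sigma>')"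
proof -
  have "describes W ty (foldr (\<lambda>i. Exists (v i) B) is \<phi>)
      (\<lambda>U \<sigma>. \<exists>\<sigma>'. (\<forall>w. w \<notin> v ` set is \<longrightarrow> \<sigma>' w = \<sigma> w) \<and>
        (\<forall>i\<in>set is. \<sigma>' (v i) \<in> hom E U B) \<and> P U \<sigma>')"
    if "describes (v ` set is \<union> W) ty \<phi> P" for "is" W
    using that
  proof (induction "is" arbitrary: W)
    case Nil
    \<comment> \<open>No entry may change, so \<sigma>' is \<sigma> by extensionality.\<close>
    show ?case by (rule describes_cong) (use Nil in \<open>auto simp: fun_eq_iff [symmetric]\<close>)
  next
    case (Cons i "is")
    have "describes (v ` set is \<union> insert (v i) W) ty \<phi> P" using Cons.prems by simp
    from describes_Exists [OF Cons.IH [OF this], unfolded ty, OF B]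
    have "describes W ty (foldr (\<lambda>i. Exists (v i) B) (i # is) \<phi>)
      (\<lambda>U \<sigma>. \<exists>b\<in>hom E U B. \<exists>\<sigma>'. (\<forall>w. w \<notin> v ` set is \<longrightarrow> \<sigma>' w = (\<sigma>(v i := b)) w) \<and>
        (\<forall>i\<in>set is. \<sigma>' (v i) \<in> hom E U B) \<and> P U \<sigma>')" by simp
    then show ?case
    proof (rule describes_cong)
      fix U \<sigma>
      show "(\<exists>b\<in>hom E U B. \<exists>\<sigma>'. (\<forall>w. w \<notin> v ` set is \<longrightarrow> \<sigma>' w = (\<sigma>(v i := b)) w) \<and>
          (\<forall>i\<in>set is. \<sigma>' (v i) \<in> hom E U B) \<and> P U \<sigma>') \<longleftrightarrow>
        (\<exists>\<sigma>'. (\<forall>w. w \<notin> v ` set (i # is) \<longrightarrow> \<sigma>' w = \<sigma> w) \<and>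
          (\<forall>i\<in>set (i # is). \<sigma>' (v i) \<in> hom E U B) \<and> P U \<sigma>')" (is "?L \<longleftrightarrow> ?R")
      proof
        assume ?L
        then obtain b \<sigma>' where b: "b \<in> hom E U B" and off: "\<And>w. w \<notin> v ` set is \<Longrightarrow> \<sigma>' w = (\<sigma>(v i := b)) w"
          and on: "\<forall>i\<in>set is. \<sigma>' (v i) \<in> hom E U B" and P: "P U \<sigma>'" by blast
        \<comment> \<open>If \<open>v i\<close> is bound again further inside, the inner binder
          determines its value; otherwise the value is b.\<close>
        have "\<sigma>' (v i) \<in> hom E U B" using off [of "v i"] on b by (cases "v i \<in> v ` set is") auto
        then show ?R using off on P by (intro exI [of _ \<sigma>']) auto
      next
        assume ?R
        then obtain \<sigma>' where "\<And>w. w \<notin> v ` set (i # is) \<Longrightarrow> \<sigma>' w = \<sigma> w"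
          "\<forall>i\<in>set (i # is). \<sigma>' (v i) \<in> hom E U B" "P U \<sigma>'" by blast
        then show ?L by (intro bexI [of _ "\<sigma>' (v i)"] exI [of _ \<sigma>']) auto
      qed
    qed
  qed
  from this [of "[1..<Suc p]"] \<phi> show ?thesis
    by (simp add: exists_list_def atLeastLessThanSuc_atLeastAtMost del: upt_Suc)
qed

end

section \<open>The subobject of tensor sums\<close>

context topos
begin

text \<open>Bracketed to the left from zero, as \<open>tensor_sum\<close> is, but free of variable
  names, so that closure properties become inductions over sums at a fixed stage.\<close>

inductive tsum :: "('o, 'm) modob \<Rightarrow> ('o, 'm) modob \<Rightarrow> ('o, 'm) abgrp \<Rightarrow> 'm \<Rightarrow> 'o \<Rightarrow> 'm \<Rightarrow> bool"
  for M N T t U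
where
  zero: "tsum M N T t U (Zero T \<cdot> bang E U)"
| add: "tsum M N T t U x \<Longrightarrow> m \<in> hom E U (Car M) \<Longrightarrow> n \<in> hom E U (Car N) \<Longrightarrow>
    tsum M N T t U (gadd T x (t \<cdot> pair E m n))"

context
  fixes M N :: "('o, 'm) modob" and T :: "('o, 'm) abgrp" and t :: 'm
  assumes T: "abelian_group_object E T" and M: "Car M \<in> Obj E" and N: "Car N \<in> Obj E"
    and t: "t \<in> hom E (Prd E (Car M) (Car N)) (Car T)"
begin

lemma tensor_hom:
  "m \<in> hom E U (Car M) \<Longrightarrow> n \<in> hom E U (Car N) \<Longrightarrow> t \<cdot> pair E m n \<in> hom E U (Car T)"
  using homD [OF t] by (simp add: hom_def)

lemma zero_hom: "U \<in> Obj E \<Longrightarrow> Zero T \<cdot> bang E U \<in> hom E U (Car T)"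
  using abgrp_typing [OF T] by (simp add: hom_def)

lemma tsum_hom: "tsum M N T t U x \<Longrightarrow> U \<in> Obj E \<Longrightarrow> x \<in> hom E U (Car T)"
  by (induction rule: tsum.induct) (blast intro: zero_hom gadd_hom [OF T] tensor_hom)+

text \<open>Sums living at different stages are added after both have been pulled back to the
  product of the stages.\<close>

lemma tsum_comp:
  assumes "tsum M N T t U x" and k: "k \<in> hom E V U"
  shows "tsum M N T t V (x \<cdot> k)"
  using assms(1)
proof (induction rule: tsum.induct)
  case zero
  show ?case
    using tsum.zero [of M N T t V] homD [OF k] hom_objs [OF k] abgrp_typing [OF T] by simp
next
  case (add x m n)
  have U: "U \<in> Obj E" using hom_objs [OF k] by simp
  note [simp] = homD [OF k] homD [OF add.hyps(2)] homD [OF add.hyps(3)] homD [OF t]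
    abgrp_typing [OF T] homD [OF tsum_hom [OF add.hyps(1) U]]
  have "tsum M N T t V (gadd T (x \<cdot> k) (t \<cdot> pair E (m \<cdot> k) (n \<cdot> k)))"
    by (rule tsum.add [OF add.IH]) (simp_all add: hom_def)
  then show ?case by simp
qed

lemma tsum_gadd:
  assumes x: "tsum M N T t U x" and "tsum M N T t U y" and U: "U \<in> Obj E"
  shows "tsum M N T t U (gadd T x y)"
  using assms(2)
proof (induction rule: tsum.induct)
  case zero
  show ?case
    using x gadd_commute [OF T tsum_hom [OF x U] zero_hom [OF U]] gadd_zero [OF T tsum_hom [OF x U]]
    by simp
next
  case (add y m n)
  show ?case
    using tsum.add [OF add.IH add.hyps(2,3)]
      gadd_assoc [OF T tsum_hom [OF x U] tsum_hom [OF add.hyps(1) U] tensor_hom [OF add.hyps(2,3)]]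
    by simp
qed

text \<open>In this context t is an arbitrary arrow M \<times> N \<rightarrow> T; the assumption
  \<open>neg\<close> isolates the property of the tensor that carries negation through a
  sum.\<close>

lemma tsum_neg:
  assumes "tsum M N T t U x" and U: "U \<in> Obj E"
    and neg: "\<And>m n. m \<in> hom E U (Car M) \<Longrightarrow> n \<in> hom E U (Car N) \<Longrightarrow>
      \<exists>m'\<in>hom E U (Car M). Neg T \<cdot> t \<cdot> pair E m n = t \<cdot> pair E m' n"
  shows "tsum M N T t U (Neg T \<cdot> x)"
  using assms(1)
proof (induction rule: tsum.induct)
  case zero
  show ?case unfolding neg_zero [OF T U] by (rule tsum.zero)
next
  case (add x m n)
  obtain m' where m': "m' \<in> hom E U (Car M)" "Neg T \<cdot> t \<cdot> pair E m n = t \<cdot> pair E m' n"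
    using neg [OF add.hyps(2,3)] by blast
  show ?case
    unfolding neg_gadd [OF T tsum_hom [OF add.hyps(1) U] tensor_hom [OF add.hyps(2,3)]] m'(2)
    by (rule tsum.add [OF add.IH m'(1) add.hyps(3)])
qed

lemma tsum_tensor:
  assumes "m \<in> hom E U (Car M)" "n \<in> hom E U (Car N)"
  shows "tsum M N T t U (t \<cdot> pair E m n)"
  using tsum.add [OF tsum.zero assms, of T t] gadd_zero [OF T tensor_hom [OF assms]] by simp

lemma tensor_sum_cong:
  assumes "\<And>i. i \<in> {1..p} \<Longrightarrow> \<sigma> (Mv i) = \<sigma>' (Mv i) \<and> \<sigma> (Nv i) = \<sigma>' (Nv i)"
  shows "interp_trm E U \<sigma> (tensor_sum T t p) = interp_trm E U \<sigma>' (tensor_sum T t p)"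
  using assms by (induction p) auto

lemma tensor_sum_tsum:
  assumes "\<forall>i\<in>{1..p}. \<sigma> (Mv i) \<in> hom E U (Car M) \<and> \<sigma> (Nv i) \<in> hom E U (Car N)"
  shows "tsum M N T t U (interp_trm E U \<sigma> (tensor_sum T t p))"
  using assms by (induction p) (auto intro: tsum.intros)

lemma tensor_sum_comp:
  assumes "\<forall>i\<in>{1..p}. \<rho> (Mv i) \<in> hom E X (Car M) \<and> \<rho> (Nv i) \<in> hom E X (Car N)"
    and a: "a \<in> hom E U X"
  shows "interp_trm E X \<rho> (tensor_sum T t p) \<cdot> a = interp_trm E U (\<lambda>w. \<rho> w \<cdot> a) (tensor_sum T t p)"
  using assms(1)
proof (induction p)
  case 0
  show ?case using homD [OF a] hom_objs [OF a] abgrp_typing [OF T] by simp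
next
  case (Suc p)
  have X: "X \<in> Obj E" using hom_objs [OF a] by simp
  have mn: "\<rho> (Mv (Suc p)) \<in> hom E X (Car M)" "\<rho> (Nv (Suc p)) \<in> hom E X (Car N)"
    using Suc.prems by simp_all
  have s: "tsum M N T t X (interp_trm E X \<rho> (tensor_sum T t p))"
    by (rule tensor_sum_tsum) (use Suc.prems in simp)
  show ?case
    using Suc homD [OF a] homD [OF mn(1)] homD [OF mn(2)] homD [OF t] homD [OF tsum_hom [OF s X]]
      abgrp_typing [OF T] by simp
qed

lemma tsum_iff:
  "tsum M N T t U x \<longleftrightarrow> (\<exists>p \<sigma>. (\<forall>i\<in>{1..p}. \<sigma> (Mv i) \<in> hom E U (Car M) \<and>
    \<sigma> (Nv i) \<in> hom E U (Car N)) \<and> x = interp_trm E U \<sigma> (tensor_sum T t p))"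
proof
  assume "tsum M N T t U x"
  then show "\<exists>p \<sigma>. (\<forall>i\<in>{1..p}. \<sigma> (Mv i) \<in> hom E U (Car M) \<and>
    \<sigma> (Nv i) \<in> hom E U (Car N)) \<and> x = interp_trm E U \<sigma> (tensor_sum T t p)"
  proof (induction rule: tsum.induct)
    case zero
    show ?case by (rule exI [of _ 0]) simp
  next
    case (add x m n)
    obtain p \<sigma> where p: "\<forall>i\<in>{1..p}. \<sigma> (Mv i) \<in> hom E U (Car M) \<and> \<sigma> (Nv i) \<in> hom E U (Car N)"
      and x: "x = interp_trm E U \<sigma> (tensor_sum T t p)" using add.IH by blast
    \<comment> \<open>The new summand is stored at index \<open>Suc p\<close>, which does not occur
      in the sum of the first p terms.\<close>
    define \<sigma>' where "\<sigma>' = \<sigma>(Mv (Suc p) := m, Nv (Suc p) := n)"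
    have eq: "\<sigma>' (Mv i) = \<sigma> (Mv i) \<and> \<sigma>' (Nv i) = \<sigma> (Nv i)" if "i \<in> {1..p}" for i
      using that by (simp add: \<sigma>'_def)
    have new: "\<sigma>' (Mv (Suc p)) = m" "\<sigma>' (Nv (Suc p)) = n" by (simp_all add: \<sigma>'_def)
    have "interp_trm E U \<sigma>' (tensor_sum T t p) = x"
      unfolding x by (rule tensor_sum_cong) (rule eq)
    then have "gadd T x (t \<cdot> pair E m n) = interp_trm E U \<sigma>' (tensor_sum T t (Suc p))"
      using new by simp
    moreover have "\<forall>i\<in>{1..Suc p}. \<sigma>' (Mv i) \<in> hom E U (Car M) \<and> \<sigma>' (Nv i) \<in> hom E U (Car N)"
      using p eq new add.hyps(2,3) by (auto simp: atLeastAtMostSuc_conv)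
    ultimately show ?case by blast
  qed
next
  assume "\<exists>p \<sigma>. (\<forall>i\<in>{1..p}. \<sigma> (Mv i) \<in> hom E U (Car M) \<and>
    \<sigma> (Nv i) \<in> hom E U (Car N)) \<and> x = interp_trm E U \<sigma> (tensor_sum T t p)"
  then show "tsum M N T t U x" using tensor_sum_tsum by blast
qed

end

end

section \<open>The extent of the formula is a subgroup containing the tensors\<close>

context geometric_topos
begin

context
  fixes M N :: "('o, 'm) modob" and T :: "('o, 'm) abgrp" and t :: 'm
  assumes T: "abelian_group_object E T" and M: "Car M \<in> Obj E" and N: "Car N \<in> Obj E"
    and t: "t \<in> hom E (Prd E (Car M) (Car N)) (Car T)"
begin

lemma least_sub_tensor_formula:
  "least_sub (Car T) (extent E Xv (Car T) (tensor_formula M N T t)) (tsum M N T t)"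
proof -
  let ?ty = "\<lambda>v. case v of Xv \<Rightarrow> Car T | Mv _ \<Rightarrow> Car M | Nv _ \<Rightarrow> Car N"
  have TO: "Car T \<in> Obj E" by (rule abgrp_typing(1) [OF T])
  \<comment> \<open>The context is grouped like the quantifiers: the variables of type N are bound
    innermost and are discharged first, leaving x at the end.\<close>
  have leaf: "describes (Nv ` {1..p} \<union> (Mv ` {1..p} \<union> {Xv})) ?ty
      (Equal (Var Xv) (tensor_sum T t p))
      (\<lambda>U \<sigma>. interp_trm E U \<sigma> (Var Xv) = interp_trm E U \<sigma> (tensor_sum T t p))" for p
  proof (rule describes_Equal [where C = "Car T"])
    fix U :: 'o and \<sigma> \<sigma>' :: "var \<Rightarrow> 'm"
    assume "\<forall>w\<in>Nv ` {1..p} \<union> (Mv ` {1..p} \<union> {Xv}). \<sigma> w = \<sigma>' w"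
    then show "interp_trm E U \<sigma> (Var Xv) = interp_trm E U \<sigma>' (Var Xv) \<and>
        interp_trm E U \<sigma> (tensor_sum T t p) = interp_trm E U \<sigma>' (tensor_sum T t p)"
      by (intro conjI tensor_sum_cong [OF T M N t]) simp_all
  next
    fix X and \<rho> :: "var \<Rightarrow> 'm"
    assume X: "X \<in> Obj E" and \<rho>: "\<forall>w\<in>Nv ` {1..p} \<union> (Mv ` {1..p} \<union> {Xv}). \<rho> w \<in> hom E X (?ty w)"
    have mn: "\<forall>i\<in>{1..p}. \<rho> (Mv i) \<in> hom E X (Car M) \<and> \<rho> (Nv i) \<in> hom E X (Car N)"
      and x: "\<rho> Xv \<in> hom E X (Car T)"
      using \<rho> [rule_format, of Xv] \<rho> [rule_format, of "Mv _"] \<rho> [rule_format, of "Nv _"] by simp_all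
    show "interp_trm E X \<rho> (Var Xv) \<in> hom E X (Car T) \<and>
        interp_trm E X \<rho> (tensor_sum T t p) \<in> hom E X (Car T)"
      using x tsum_hom [OF T M N t tensor_sum_tsum [OF T M N t mn] X] by simp
    show "interp_trm E X \<rho> (Var Xv) \<cdot> a = interp_trm E U (\<lambda>w. \<rho> w \<cdot> a) (Var Xv) \<and>
        interp_trm E X \<rho> (tensor_sum T t p) \<cdot> a =
        interp_trm E U (\<lambda>w. \<rho> w \<cdot> a) (tensor_sum T t p)" if "a \<in> hom E U X" for U a
      using tensor_sum_comp [OF T M N t mn that] by simp
  qed
  note ex = describes_exists_list [OF describes_exists_list [OF leaf]]
  have "describes {Xv} ?ty (tensor_formula M N T t) (\<lambda>U \<sigma>. tsum M N T t U (\<sigma> Xv))"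
    unfolding tensor_formula_def
  proof (rule describes_cong [OF describes_Disj [OF ex]])
    fix U :: 'o and \<sigma> :: "var \<Rightarrow> 'm"
    show "(\<exists>p \<sigma>'. (\<forall>w. w \<notin> Mv ` {1..p} \<longrightarrow> \<sigma>' w = \<sigma> w) \<and>
        (\<forall>i\<in>{1..p}. \<sigma>' (Mv i) \<in> hom E U (Car M)) \<and>
        (\<exists>\<sigma>''. (\<forall>w. w \<notin> Nv ` {1..p} \<longrightarrow> \<sigma>'' w = \<sigma>' w) \<and>
          (\<forall>i\<in>{1..p}. \<sigma>'' (Nv i) \<in> hom E U (Car N)) \<and>
          interp_trm E U \<sigma>'' (Var Xv) = interp_trm E U \<sigma>'' (tensor_sum T t p))) \<longleftrightarrow>
      tsum M N T t U (\<sigma> Xv)" (is "?L \<longleftrightarrow> ?R")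
    proof
      assume ?L
      then obtain p \<sigma>' \<sigma>'' where 1: "\<forall>w. w \<notin> Mv ` {1..p} \<longrightarrow> \<sigma>' w = \<sigma> w"
        "\<forall>i\<in>{1..p}. \<sigma>' (Mv i) \<in> hom E U (Car M)" "\<forall>w. w \<notin> Nv ` {1..p} \<longrightarrow> \<sigma>'' w = \<sigma>' w"
        "\<forall>i\<in>{1..p}. \<sigma>'' (Nv i) \<in> hom E U (Car N)"
        and 2: "interp_trm E U \<sigma>'' (Var Xv) = interp_trm E U \<sigma>'' (tensor_sum T t p)" by blast
      have "\<sigma>'' (Mv i) = \<sigma>' (Mv i)" for i using 1(3) by blast
      then have "\<forall>i\<in>{1..p}. \<sigma>'' (Mv i) \<in> hom E U (Car M) \<and> \<sigma>'' (Nv i) \<in> hom E U (Car N)"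
        using 1(2,4) by simp
      moreover have "\<sigma>'' Xv = \<sigma> Xv" using 1(1,3) by (metis imageE var.distinct(1,3))
      ultimately show ?R using tsum_iff [OF T M N t] 2 by auto
    next
      assume ?R
      then obtain p \<tau> where
        \<tau>: "\<forall>i\<in>{1..p}. \<tau> (Mv i) \<in> hom E U (Car M) \<and> \<tau> (Nv i) \<in> hom E U (Car N)"
        and x: "\<sigma> Xv = interp_trm E U \<tau> (tensor_sum T t p)"
        using tsum_iff [OF T M N t] by blast
      \<comment> \<open>\<open>?m\<close> and \<open>?n\<close> are the environments inside the
        outer and inside the inner block of quantifiers. Both keep the value of x, and they differ
        from \<sigma> only at indices 1 to p.\<close>
      let ?m = "\<lambda>w. if w \<in> Mv ` {1..p} then \<tau> w else \<sigma> w"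
      let ?n = "\<lambda>w. if w \<in> Nv ` {1..p} then \<tau> w else ?m w"
      have "interp_trm E U ?n (tensor_sum T t p) = interp_trm E U \<tau> (tensor_sum T t p)"
        by (rule tensor_sum_cong [OF T M N t]) auto
      then show ?L
        using \<tau> x by (intro exI [of _ p] exI [of _ ?m] conjI exI [of _ ?n]) auto
    qed
  qed (simp_all add: M N)
  \<comment> \<open>Over the context T the variable x denotes the identity, so its value at an
    element a is a itself. The undefined entries lie outside the context
    \<open>{Xv}\<close>.\<close>
  then have "least_sub (Car T)
      (interp E (tensor_formula M N T t) (Car T) ((\<lambda>_. undefined)(Xv := Id E (Car T))))
      (\<lambda>U a. tsum M N T t U (((\<lambda>_. undefined)(Xv := Id E (Car T))) Xv \<cdot> a))"
    by (rule describesD(2) [OF _ TO]) (simp add: TO Id_hom)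
  then show ?thesis
    unfolding extent_def least_sub_def using homD by simp
qed

text \<open>The zero element is the empty sum at the terminal stage.\<close>

lemma least_tsum_zero:
  assumes "least_sub (Car T) s (tsum M N T t)"
  shows "sub_le E (Zero T) s"
  using least_subD(2) [OF assms zero_hom [OF T M N t One_Obj] tsum.zero] abgrp_typing [OF T] by simp

text \<open>At stage M \<times> N the arrow t is the tensor of the two projections, hence a sum with
  one term.\<close>

lemma least_tsum_tensor:
  assumes "least_sub (Car T) s (tsum M N T t)"
  shows "sub_le E t s"
  by (rule least_subD(2) [OF assms t])
    (use tsum_tensor [OF T M N t, of "Fst E (Car M) (Car N)" _ "Snd E (Car M) (Car N)"]
      homD [OF t] M N in \<open>simp add: hom_def\<close>)

text \<open>The preimage of s under negation contains all sums, because the negative of a sum is a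
  sum; by leastness it contains s.\<close>

lemma least_tsum_neg:
  assumes s: "least_sub (Car T) s (tsum M N T t)"
    and neg: "\<And>U m n. m \<in> hom E U (Car M) \<Longrightarrow> n \<in> hom E U (Car N) \<Longrightarrow>
      \<exists>m'\<in>hom E U (Car M). Neg T \<cdot> t \<cdot> pair E m n = t \<cdot> pair E m' n"
  shows "sub_le E (Neg T \<cdot> s) s"
proof -
  have sS: "s \<in> Sub E (Car T)" by (rule least_subD(1) [OF s])
  have nh: "Neg T \<in> hom E (Car T) (Car T)" using abgrp_typing [OF T] by (simp add: hom_def)
  obtain n where n: "n \<in> Sub E (Car T)"
    and le: "\<And>U a. a \<in> hom E U (Car T) \<Longrightarrow> sub_le E a n \<longleftrightarrow> sub_le E (Neg T \<cdot> a) s"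
    using preimage_exists [OF sS nh] by metis
  have "sub_le E s n"
  proof (rule least_subD(3) [OF s n])
    fix U a
    assume a: "a \<in> hom E U (Car T)" and sum: "tsum M N T t U a"
    have U: "U \<in> Obj E" using hom_objs [OF a] by simp
    show "sub_le E a n"
      unfolding le [OF a]
      by (rule least_subD(2) [OF s Comp_hom [OF a nh] tsum_neg [OF T M N t sum U neg]])
  qed
  then show ?thesis using le [of s "Dom E s"] Sub_Arr [OF sS] by (simp add: hom_def)
qed

text \<open>
  Closure under addition: for a sum \<open>a\<close>, \<open>{y | \<forall>u. y + a u \<in> s}\<close> contains all sums, hence \<open>s\<close>; so
  \<open>{x | \<forall>y \<in> s. y + x \<in> s}\<close> contains all sums, hence \<open>s\<close>.
\<close>

lemma least_tsum_gadd:
  assumes s: "least_sub (Car T) s (tsum M N T t)"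
  shows "sub_le E (gadd T (s \<cdot> Fst E (Dom E s) (Dom E s)) (s \<cdot> Snd E (Dom E s) (Dom E s))) s"
proof -
  have sS: "s \<in> Sub E (Car T)" by (rule least_subD(1) [OF s])
  let ?S = "Dom E s"
  note [simp] = Sub_Arr [OF sS] abgrp_typing [OF T]
  have S: "?S \<in> Obj E" by simp
  have 1: "sub_le E (gadd T (s \<cdot> Fst E ?S U) (a \<cdot> Snd E ?S U)) s"
    if a: "a \<in> hom E U (Car T)" and sum: "tsum M N T t U a" for U a
  proof -
    have U [simp]: "U \<in> Obj E" using hom_objs [OF a] by simp
    note [simp] = homD [OF a]
    let ?f = "gadd T (Fst E (Car T) U) (a \<cdot> Snd E (Car T) U)"
    have f: "?f \<in> hom E (Prd E (Car T) U) (Car T)" by (simp add: hom_def)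
    obtain n where n: "n \<in> Sub E (Car T)"
      and le: "\<And>V b. b \<in> hom E V (Car T) \<Longrightarrow>
        sub_le E b n \<longleftrightarrow> sub_le E (?f \<cdot> pair E (b \<cdot> Fst E V U) (Snd E V U)) s"
      using forall_exists [OF sS f abgrp_typing(1) [OF T] U] by metis
    have "sub_le E s n"
    proof (rule least_subD(3) [OF s n])
      fix V b
      assume b: "b \<in> hom E V (Car T)" and sum': "tsum M N T t V b"
      have V [simp]: "V \<in> Obj E" using hom_objs [OF b] by simp
      note [simp] = homD [OF b]
      have p: "Fst E V U \<in> hom E (Prd E V U) V" "Snd E V U \<in> hom E (Prd E V U) U"
        by (simp_all add: hom_def)
      \<comment> \<open>The sums b over V and a over U become comparable at stage V \<times> U,
        where b + a is literally a sum.\<close>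
      have "tsum M N T t (Prd E V U) (gadd T (b \<cdot> Fst E V U) (a \<cdot> Snd E V U))"
        by (rule tsum_gadd [OF T M N t tsum_comp [OF T M N t sum' p(1)]
              tsum_comp [OF T M N t sum p(2)]]) simp
      then have "sub_le E (gadd T (b \<cdot> Fst E V U) (a \<cdot> Snd E V U)) s"
        by (rule least_subD(2) [OF s, rotated]) (simp add: hom_def)
      then show "sub_le E b n" unfolding le [OF b] by simp
    qed
    then show ?thesis using le [of s ?S] by (simp add: hom_def)
  qed
  \<comment> \<open>The element of s is written first to match fact \<open>1\<close>, which is
    applied through the exchange of factors U \<times> S \<rightarrow> S \<times> U. Commutativity
    restores the order at the end.\<close>
  let ?g = "gadd T (s \<cdot> Snd E (Car T) ?S) (Fst E (Car T) ?S)"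
  have g: "?g \<in> hom E (Prd E (Car T) ?S) (Car T)" by (simp add: hom_def)
  obtain n where n: "n \<in> Sub E (Car T)"
    and le: "\<And>V b. b \<in> hom E V (Car T) \<Longrightarrow>
      sub_le E b n \<longleftrightarrow> sub_le E (?g \<cdot> pair E (b \<cdot> Fst E V ?S) (Snd E V ?S)) s"
    using forall_exists [OF sS g abgrp_typing(1) [OF T] S] by metis
  have "sub_le E s n"
  proof (rule least_subD(3) [OF s n])
    fix U a
    assume a: "a \<in> hom E U (Car T)" and sum: "tsum M N T t U a"
    have U [simp]: "U \<in> Obj E" using hom_objs [OF a] by simp
    note [simp] = homD [OF a]
    have "sub_le E (gadd T (s \<cdot> Fst E ?S U) (a \<cdot> Snd E ?S U) \<cdot> pair E (Snd E U ?S) (Fst E U ?S)) s"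
      using sub_le_comp [OF 1 [OF a sum], of "pair E (Snd E U ?S) (Fst E U ?S)"] by simp
    then show "sub_le E a n" unfolding le [OF a] by simp
  qed
  then have "sub_le E (gadd T (s \<cdot> Snd E ?S ?S) (s \<cdot> Fst E ?S ?S)) s"
    using le [of s ?S] by (simp add: hom_def)
  moreover have "gadd T (s \<cdot> Snd E ?S ?S) (s \<cdot> Fst E ?S ?S) = gadd T (s \<cdot> Fst E ?S ?S) (s \<cdot> Snd E ?S ?S)"
    by (rule gadd_commute [OF T, of _ "Prd E ?S ?S"]) (simp_all add: hom_def)
  ultimately show ?thesis by simp
qed

end

end

section \<open>Every element of the tensor product is internally a finite sum of tensors\<close>

theorem propositionC18:
  fixes E :: "('o, 'm) topos_data"
    and A :: "('o, 'm) ringob" and M N :: "('o, 'm) modob"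
    and T :: "('o, 'm) abgrp" and \<Phi> :: "('o, 'm) abgrp \<Rightarrow> 'm \<Rightarrow> 'm"
  assumes "topos E" and "geometric_category E"
    and "\<And>A' M' N'. ring_object E A' \<Longrightarrow> right_module E A' M' \<Longrightarrow> left_module E A' N' \<Longrightarrow>
      \<exists>T' \<Phi>'. represents_tensor E A' M' N' T' \<Phi>'"
    and "ring_object E A" and "right_module E A M" and "left_module E A N"
    and "represents_tensor E A M N T \<Phi>"
  shows "valid E Xv (Car T) (tensor_formula M N T (tensor_map E M N T \<Phi>)) \<and>
    is_iso E (extent E Xv (Car T) (tensor_formula M N T (tensor_map E M N T \<Phi>)))"
proof -
  interpret geometric_topos E
    using assms(1,2) by (rule geometric_topos.intro)
  note tensor = assms(4-7)
  let ?t = "tensor_map E M N T \<Phi>" let ?s = "extent E Xv (Car T) (tensor_formula M N T ?t)"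
  have T: "abelian_group_object E T" and M: "abelian_group_object E M"
    and N: "abelian_group_object E N" and t: "?t \<in> hom E (Prd E (Car M) (Car N)) (Car T)"
    using tensor_group [OF tensor] tensor_modules(2,4) [OF tensor] tensor_map_props(1) [OF tensor]
    by blast+
  note ctx = T abgrp_typing(1) [OF M] abgrp_typing(1) [OF N] t
  note least = least_sub_tensor_formula [OF ctx]
  have s: "?s \<in> Sub E (Car T)" by (rule least_subD(1) [OF least])
  \<comment> \<open>The witness is -m, since -(m \<otimes> n) = (-m) \<otimes> n.\<close>
  have neg: "\<exists>m'\<in>hom E U (Car M). Neg T \<cdot>\<^bsub>E\<^esub> ?t \<cdot>\<^bsub>E\<^esub> pair E m n = ?t \<cdot>\<^bsub>E\<^esub> pair E m' n"
    if "m \<in> hom E U (Car M)" "n \<in> hom E U (Car N)" for U m n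
  proof
    show "Neg T \<cdot>\<^bsub>E\<^esub> ?t \<cdot>\<^bsub>E\<^esub> pair E m n = ?t \<cdot>\<^bsub>E\<^esub> pair E (Neg M \<cdot>\<^bsub>E\<^esub> m) n"
      by (rule tensor_map_neg [OF tensor that])
    show "Neg M \<cdot>\<^bsub>E\<^esub> m \<in> hom E U (Car M)"
      by (rule Comp_hom [OF that(1)]) (use abgrp_typing [OF M] in \<open>simp add: hom_def\<close>)
  qed
  obtain G :: "('o, 'm) abgrp"
    where G: "abelian_group_object E G" "Car G = Dom E ?s" "?s \<in> HomZ E G T"
    using subgroup_object [OF T s least_tsum_zero [OF ctx least] least_tsum_neg [OF ctx least neg]
        least_tsum_gadd [OF ctx least]] by blast
  have "sub_le E (Id E (Car T)) ?s"
    by (rule tensor_subgroup_full [OF tensor G(1) s G(2,3) least_tsum_tensor [OF ctx least]])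
  \<comment> \<open>That the extent contains the identity is validity; it also gives the
    monomorphism a section, hence an inverse.\<close>
  then show ?thesis
    unfolding valid_def using s split_mono_iso [OF s] by blast
qed

end
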